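(* Let $G$ be an analytic Moufang loop of dimension $r$ and let $(S,T)$ be a differentiable birepresentation of $G$ in $GL_n$, so that $S_g,T_g$ satisfy the generalized Lie equations \[ v_j^{n}(g)\frac{\partial S_g}{\partial g^{n}}=S_g\,S_j(g),\qquad v_j^{n}(g)\frac{\partial T_g}{\partial g^{n}}=T_j(g)\,T_g,\qquad j=1,\dots,r . \] Then the integrability conditions of these equations (arising from the equality of the mixed second partial derivatives of $S_g$ and of $T_g$ with respect to the coordinates $g^{j},g^{k}$) read as the following commutation relations, which hold for all $j,k=1,\dots,r$ and all $g$ in the coordinate neighbourhood of $e$: \[ [S_j(g),S_k(g)]=c_{jk}^{n}(g)S_n(g)-2[S_j(g),T_k(g)], \] \[ [T_j(g),T_k(g)]=-c_{jk}^{n}(g)T_n(g)-2[T_j(g),S_k(g)]. \]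
   Context: A Moufang loop is a quasigroup $G$ with unit element $e$ satisfying $(ag)(ha)=a(gh)a$ for all $a,g,h\in G$. It is analytic if $G$ is also a real analytic manifold and the multiplication and the inversion $g\mapsto g^{-1}$ are analytic maps. Let $r=\dim G$ and let $g^{i}$ ($i=1,\dots,r$) denote the local coordinates of $g$ in a neighbourhood of $e$. Summation over repeated upper and lower indices from $1$ to $r$ is understood. A (linear) birepresentation of $G$ in $GL_n$ is a pair $(S,T)$ of maps $g\mapsto S_g$, $g\mapsto T_g$ from $G$ to $GL_n$ such that $S_e=T_e=\mathrm{id}$ and, for all $g,h\in G$, \[ T_gS_gS_h=S_{gh}T_g,\qquad S_gT_gT_h=T_{hg}S_g . \] It is differentiable if both maps are differentiable. Its generators are \[ S_j=\frac{\partial S_g}{\partial g^{j}}\Big|_{g=e},\qquad T_j=\frac{\partial T_g}{\partial g^{j}}\Big|_{g=e},\qquad j=1,\dots,r, \] and its derivative generators are \[ S_j(g)=T_gS_jT_g^{-1},\qquad T_j(g)=S_g^{-1}T_jS_g . \] The auxiliary functions of $G$ are \[ v_j^{n}(g)=\frac{\partial (gh)^{n}}{\partial h^{j}}\Big|_{h=e},\qquad n,j=1,\dots,r, \] and the structure functions $c_{jk}^{n}(g)$ of $G$ are defined by the generalized Maurer-Cartan equations \[ v_j^{n}(g)\frac{\partial v_k^{i}(g)}{\partial g^{n}}-v_k^{n}(g)\frac{\partial v_j^{i}(g)}{\partial g^{n}}=c_{jk}^{n}(g)\,v_n^{i}(g),\qquad i,j,k=1,\dots,r . \] For linear operators $A,B$,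 $[A,B]=AB-BA$. *)

theory Defs
  imports "HOL-Analysis.Analysis"
begin

section \<open>Real analytic manifolds\<close>

text \<open>
  A function between Euclidean spaces is analytic at \<open>x\<close> if it is the sum of a power series in
  the coordinates of \<open>y - x\<close> for all \<open>y\<close> in some ball around \<open>x\<close>.  The multi-indices are the
  functions in \<open>Basis \<rightarrow>\<^sub>E UNIV\<close>.  The definition is meant for open \<open>S\<close>: the values of \<open>f\<close> on a
  full neighbourhood of each point of \<open>S\<close> are involved.
\<close>

definition real_analytic_on ::
    "('a::euclidean_space \<Rightarrow> 'b::euclidean_space) \<Rightarrow> 'a set \<Rightarrow> bool"
  where "real_analytic_on f S \<longleftrightarrow>
    (\<forall>x\<in>S. \<exists>\<epsilon>>0. \<exists>a :: ('a \<Rightarrow> nat) \<Rightarrow> 'b. \<forall>y\<in>ball x \<epsilon>.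
      ((\<lambda>\<alpha>. (\<Prod>b\<in>Basis. ((y - x) \<bullet> b) ^ \<alpha> b) *\<^sub>R a \<alpha>) has_sum f y) (Basis \<rightarrow>\<^sub>E UNIV))"

type_synonym ('m, 'a) chart = "'m set \<times> ('m \<Rightarrow> 'a)"

abbreviation chart_dom :: "('m, 'a) chart \<Rightarrow> 'm set"
  where "chart_dom X \<equiv> fst X"

abbreviation chart_map :: "('m, 'a) chart \<Rightarrow> 'm \<Rightarrow> 'a"
  where "chart_map X \<equiv> snd X"

definition chart_inv :: "('m, 'a) chart \<Rightarrow> 'a \<Rightarrow> 'm"
  where "chart_inv X = inv_into (chart_dom X) (chart_map X)"

definition is_chart :: "('m::topological_space, 'a::euclidean_space) chart \<Rightarrow> bool"
  where "is_chart X \<longleftrightarrow>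
    open (chart_dom X) \<and> open (chart_map X ` chart_dom X) \<and>
    homeomorphism (chart_dom X) (chart_map X ` chart_dom X) (chart_map X) (chart_inv X)"

text \<open>
  The manifold is the whole type \<open>'m\<close>.  Hausdorffness is imposed by the sort \<open>t2_space\<close> where
  manifolds are used; second countability, on which conventions differ, is not required.
\<close>

definition analytic_atlas :: "('m::topological_space, 'a::euclidean_space) chart set \<Rightarrow> bool"
  where "analytic_atlas \<A> \<longleftrightarrow>
    (\<forall>X\<in>\<A>. is_chart X) \<and> (\<Union>X\<in>\<A>. chart_dom X) = UNIV \<and>
    (\<forall>X\<in>\<A>. \<forall>Y\<in>\<A>. real_analytic_on (chart_map Y \<circ> chart_inv X)
                      (chart_map X ` (chart_dom X \<inter> chart_dom Y)))"

definition prod_atlas ::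
    "('m, 'a) chart set \<Rightarrow> ('k, 'b) chart set \<Rightarrow> ('m \<times> 'k, 'a \<times> 'b) chart set"
  where "prod_atlas \<A> \<B> =
    {(chart_dom X \<times> chart_dom Y, map_prod (chart_map X) (chart_map Y)) | X Y. X \<in> \<A> \<and> Y \<in> \<B>}"

definition analytic_map ::
    "('m::topological_space, 'a::euclidean_space) chart set \<Rightarrow>
     ('k::topological_space, 'b::euclidean_space) chart set \<Rightarrow> ('m \<Rightarrow> 'k) \<Rightarrow> bool"
  where "analytic_map \<A> \<B> F \<longleftrightarrow>
    continuous_on UNIV F \<and>
    (\<forall>X\<in>\<A>. \<forall>Y\<in>\<B>. real_analytic_on (chart_map Y \<circ> F \<circ> chart_inv X)
                      (chart_map X ` (chart_dom X \<inter> F -` chart_dom Y)))"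

definition differentiable_map ::
    "('m, 'a::euclidean_space) chart set \<Rightarrow> ('m \<Rightarrow> 'b::real_normed_vector) \<Rightarrow> bool"
  where "differentiable_map \<A> F \<longleftrightarrow>
    (\<forall>X\<in>\<A>. (F \<circ> chart_inv X) differentiable_on (chart_map X ` chart_dom X))"

text \<open>The partial derivative \<open>\<partial>F / \<partial>g\<^sup>j\<close> at \<open>g\<close>, in the local coordinates given by the chart \<open>X\<close>.\<close>

definition coord_deriv ::
    "('m, real^'r::finite) chart \<Rightarrow> 'r \<Rightarrow> ('m \<Rightarrow> 'b::real_normed_vector) \<Rightarrow> 'm \<Rightarrow> 'b"
  where "coord_deriv X j F g =
    vector_derivative (\<lambda>t. F (chart_inv X (chart_map X g + t *\<^sub>R axis j 1))) (at 0)"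


section \<open>Analytic Moufang loops\<close>

text \<open>
  Putting \<open>g = e\<close> in the identity below gives \<open>a(ha) = (ah)a\<close>, so the bracketing of \<open>a(gh)a\<close> on
  its right-hand side is immaterial.
\<close>

locale moufang_loop =
  fixes mul :: "'g \<Rightarrow> 'g \<Rightarrow> 'g" (infixl "\<odot>" 70) and e :: 'g
  assumes left_unit: "e \<odot> g = g"
    and right_unit: "g \<odot> e = g"
    and left_division: "\<exists>!x. a \<odot> x = b"
    and right_division: "\<exists>!x. x \<odot> a = b"
    and moufang: "(a \<odot> g) \<odot> (h \<odot> a) = (a \<odot> (g \<odot> h)) \<odot> a"

definition loop_inv :: "('g \<Rightarrow> 'g \<Rightarrow> 'g) \<Rightarrow> 'g \<Rightarrow> 'g \<Rightarrow> 'g"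
  where "loop_inv mul e g = (THE h. mul g h = e \<and> mul h g = e)"

locale analytic_moufang_loop = moufang_loop mul e
  for mul :: "'g::t2_space \<Rightarrow> 'g \<Rightarrow> 'g" and e :: 'g +
  fixes \<A> :: "('g, real^'r::finite) chart set"
  assumes analytic_atlas: "analytic_atlas \<A>"
    and analytic_mult: "analytic_map (prod_atlas \<A> \<A>) \<A> (\<lambda>(g, h). mul g h)"
    and analytic_inv: "analytic_map \<A> \<A> (loop_inv mul e)"

text \<open>\<open>aux_fun mul e X j n g\<close> is \<open>v\<^sub>j\<^sup>n(g)\<close>.\<close>

definition aux_fun ::
    "('g \<Rightarrow> 'g \<Rightarrow> 'g) \<Rightarrow> 'g \<Rightarrow> ('g, real^'r::finite) chart \<Rightarrow> 'r \<Rightarrow> 'r \<Rightarrow> 'g \<Rightarrow> real"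
  where "aux_fun mul e X j n g = coord_deriv X j (\<lambda>h. chart_map X (mul g h) $ n) e"

text \<open>
  \<open>structure_fun mul e X j k n g\<close> is \<open>c\<^sub>j\<^sub>k\<^sup>n(g)\<close>, the unique solution of the generalized
  Maurer-Cartan equations.
\<close>

definition structure_fun ::
    "('g \<Rightarrow> 'g \<Rightarrow> 'g) \<Rightarrow> 'g \<Rightarrow> ('g, real^'r::finite) chart \<Rightarrow> 'r \<Rightarrow> 'r \<Rightarrow> 'r \<Rightarrow> 'g \<Rightarrow> real"
  where "structure_fun mul e X j k n g =
    (THE c :: 'r \<Rightarrow> real. \<forall>i.
        (\<Sum>m\<in>UNIV. aux_fun mul e X j m g * coord_deriv X m (aux_fun mul e X k i) g
                 - aux_fun mul e X k m g * coord_deriv X m (aux_fun mul e X j i) g)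
        = (\<Sum>m\<in>UNIV. c m * aux_fun mul e X m i g)) n"


section \<open>Birepresentations\<close>

text \<open>
  The sort \<open>real_normed_field\<close> covers the real and the complex numbers, so matrices over either
  field are admitted.
\<close>

locale birepresentation = moufang_loop mul e
  for mul :: "'g \<Rightarrow> 'g \<Rightarrow> 'g" and e :: 'g +
  fixes S T :: "'g \<Rightarrow> 'k::real_normed_field^'n::finite^'n"
  assumes invertible_S: "invertible (S g)"
    and invertible_T: "invertible (T g)"
    and S_unit: "S e = mat 1"
    and T_unit: "T e = mat 1"
    and birep_S: "T g ** S g ** S h = S (mul g h) ** T g"
    and birep_T: "S g ** T g ** T h = T (mul h g) ** S g"

text \<open>
  The derivative generators \<open>S\<^sub>j(g) = T\<^sub>g S\<^sub>j T\<^sub>g\<^sup>-\<^sup>1\<close> and \<open>T\<^sub>j(g) = S\<^sub>g\<^sup>-\<^sup>1 T\<^sub>j S\<^sub>g\<close>, where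
  the generators \<open>S\<^sub>j\<close>, \<open>T\<^sub>j\<close> are the partial derivatives at the unit.
\<close>

definition S_deriv_gen ::
    "'g \<Rightarrow> ('g, real^'r::finite) chart \<Rightarrow> ('g \<Rightarrow> 'k::real_normed_field^'n::finite^'n) \<Rightarrow>
     ('g \<Rightarrow> 'k^'n^'n) \<Rightarrow> 'r \<Rightarrow> 'g \<Rightarrow> 'k^'n^'n"
  where "S_deriv_gen e X S T j g = T g ** coord_deriv X j S e ** matrix_inv (T g)"

definition T_deriv_gen ::
    "'g \<Rightarrow> ('g, real^'r::finite) chart \<Rightarrow> ('g \<Rightarrow> 'k::real_normed_field^'n::finite^'n) \<Rightarrow>
     ('g \<Rightarrow> 'k^'n^'n) \<Rightarrow> 'r \<Rightarrow> 'g \<Rightarrow> 'k^'n^'n"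
  where "T_deriv_gen e X S T j g = matrix_inv (S g) ** coord_deriv X j T e ** S g"

definition commutator :: "'k::comm_ring_1^'n::finite^'n \<Rightarrow> 'k^'n^'n \<Rightarrow> 'k^'n^'n"
  where "commutator A B = A ** B - B ** A"

end

theory Submission
  imports Defs
begin

text \<open>
  Let \<open>V\<^sub>j = v\<^sub>j\<^sup>n \<partial>\<^sub>n\<close> be the vector fields along which \<open>g\<close> moves to \<open>gh\<close> when \<open>h\<close> leaves \<open>e\<close>.
  Both generalized Lie equations come from differentiating an identity for \<open>S\<^sub>g\<^sub>h\<close> or \<open>T\<^sub>g\<^sub>h\<close> at
  \<open>h = e\<close>: with \<open>h = e\<close> the first axiom gives \<open>T\<^sub>g S\<^sub>g = S\<^sub>g T\<^sub>g\<close>, so \<open>S\<^sub>g\<^sub>h = S\<^sub>g T\<^sub>g S\<^sub>h T\<^sub>g\<^sup>-\<^sup>1\<close>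
  and \<open>V\<^sub>j S = S \<sigma>\<^sub>j\<close> with \<open>\<sigma>\<^sub>j(g) = T\<^sub>g S\<^sub>j T\<^sub>g\<^sup>-\<^sup>1\<close>.  A Moufang loop has the inverse property and
  \<open>(gh)\<^sup>-\<^sup>1 = h\<^sup>-\<^sup>1 g\<^sup>-\<^sup>1\<close>; therefore \<open>(T\<^sup>-\<^sup>1, S\<^sup>-\<^sup>1)\<close> is a birepresentation as well
  (\<open>dual_birepresentation\<close>), which turns the first axiom into \<open>T\<^sub>g\<^sub>h = S\<^sub>g\<^sup>-\<^sup>1 T\<^sub>h S\<^sub>g T\<^sub>g\<close> and gives
  \<open>V\<^sub>j T = \<tau>\<^sub>j T\<close> with \<open>\<tau>\<^sub>j(g) = S\<^sub>g\<^sup>-\<^sup>1 T\<^sub>j S\<^sub>g\<close>.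

  Regularity: \<open>S\<close> and \<open>T\<close> are only assumed differentiable, but the right-hand sides of the Lie equations
  are differentiable again and the matrix \<open>v\<close> is invertible, because left translations are inverted by
  left translations.  Hence all partial derivatives of \<open>S\<close> and \<open>T\<close> are differentiable, the mixed second
  ones agree (\<open>mixed_derivatives_symmetric\<close>), and the second-order terms cancel in
  \<open>V\<^sub>j V\<^sub>k S - V\<^sub>k V\<^sub>j S = c\<^sub>j\<^sub>k\<^sup>n V\<^sub>n S\<close> (\<open>frame_deriv_bracket\<close>).  Since \<open>V\<^sub>j \<sigma>\<^sub>k = [\<tau>\<^sub>j, \<sigma>\<^sub>k]\<close>, this reads
  \<open>[\<sigma>\<^sub>j, \<sigma>\<^sub>k] + [\<tau>\<^sub>j, \<sigma>\<^sub>k] - [\<tau>\<^sub>k, \<sigma>\<^sub>j] = c\<^sub>j\<^sub>k\<^sup>n \<sigma>\<^sub>n\<close>.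

  It remains to see that both mixed brackets equal \<open>[\<sigma>\<^sub>j, \<tau>\<^sub>k]\<close>, that is
  \<open>[\<sigma>\<^sub>j, \<tau>\<^sub>k] + [\<sigma>\<^sub>k, \<tau>\<^sub>j] = 0\<close> at every \<open>g\<close>.  This is the infinitesimal form of an exact identity:
  \<open>T\<^sub>g S\<^sub>h T\<^sub>g\<^sup>-\<^sup>1\<close> and \<open>S\<^sub>g\<^sup>-\<^sup>1 T\<^sub>h S\<^sub>g\<close> commute for all \<open>g\<close> and \<open>h\<close> (\<open>isotope_translations_commute\<close>).
  Letting \<open>h\<close> leave \<open>e\<close> in the direction \<open>w\<close> shows that \<open>\<sigma>(w)\<close> and \<open>\<tau>(w)\<close> commute, and polarization in \<open>w\<close>
  gives the claim.  The relations for \<open>T\<close> are those for \<open>S\<close> in the birepresentation \<open>(T\<^sup>-\<^sup>1, S\<^sup>-\<^sup>1)\<close>,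
  whose derivative generators are \<open>-\<tau>\<^sub>j\<close> and \<open>-\<sigma>\<^sub>j\<close>.
\<close>

section \<open>Differentiation of real analytic functions\<close>

text \<open>
  By the Weierstrass M-test the differentiated series converges uniformly relative to the norm of the
  direction, so the differentiation theorem for series applies.
\<close>

lemma has_derivative_sums_of_partials:
  fixes u :: "nat \<Rightarrow> 'a::euclidean_space \<Rightarrow> 'b::banach"
  assumes S: "convex S" "open S" and y: "y \<in> S"
    and deriv: "\<And>n z. z \<in> S \<Longrightarrow> (u n has_derivative (\<lambda>h. \<Sum>b\<in>Basis. (h \<bullet> b) *\<^sub>R p n b z)) (at z)"
    and bound: "\<And>n b z. z \<in> S \<Longrightarrow> b \<in> Basis \<Longrightarrow> norm (p n b z) \<le> M n"
    and M: "summable M"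
    and f: "\<And>z. z \<in> S \<Longrightarrow> (\<lambda>n. u n z) sums f z"
  shows "(f has_derivative (\<lambda>h. \<Sum>b\<in>Basis. (h \<bullet> b) *\<^sub>R (\<Sum>n. p n b y))) (at y)"
proof -
  define D where "D z h = (\<Sum>b\<in>Basis. (h \<bullet> b) *\<^sub>R (\<Sum>n. p n b z))" for z h
  have ps: "summable (\<lambda>n. p n b z)" if "z \<in> S" "b \<in> Basis" for b z
    by (rule summable_comparison_test[OF _ M]) (use bound that in blast)
  have Mn: "0 \<le> M n" for n
    using bound[OF y SOME_Basis] norm_ge_zero by (rule order_trans[rotated])
  have tail: "norm ((\<Sum>i<n. p i b z) - (\<Sum>i. p i b z)) \<le> (\<Sum>i. M (i + n))"
    if zb: "z \<in> S" "b \<in> Basis" for n b z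
  proof -
    have "norm ((\<Sum>i<n. p i b z) - (\<Sum>i. p i b z)) = norm (\<Sum>i. p (i + n) b z)"
      using suminf_minus_initial_segment[OF ps[OF zb], of n] by (simp add: norm_minus_commute)
    also have "\<dots> \<le> (\<Sum>i. M (i + n))"
      by (rule norm_suminf_le) (use bound zb M in \<open>auto simp: summable_iff_shift\<close>)
    finally show ?thesis .
  qed
  have unif: "\<forall>\<^sub>F n in sequentially. \<forall>z\<in>S. \<forall>h.
      norm ((\<Sum>i<n. (\<Sum>b\<in>Basis. (h \<bullet> b) *\<^sub>R p i b z)) - D z h) \<le> \<epsilon> * norm h" if "\<epsilon> > 0" for \<epsilon>
  proof -
    have "(\<lambda>n. \<Sum>i. M (i + n)) \<longlonglongrightarrow> 0"
      using suminf_exist_split2[OF M] .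
    then have "\<forall>\<^sub>F n in sequentially. (\<Sum>i. M (i + n)) < \<epsilon> / DIM('a)"
      using that by (intro order_tendstoD) (auto)
    then show ?thesis
    proof (rule eventually_mono, intro ballI allI)
      fix n z h
      assume n: "(\<Sum>i. M (i + n)) < \<epsilon> / DIM('a)" and z: "z \<in> S"
      have "(\<Sum>i<n. (\<Sum>b\<in>Basis. (h \<bullet> b) *\<^sub>R p i b z)) - D z h
          = (\<Sum>b\<in>Basis. (h \<bullet> b) *\<^sub>R ((\<Sum>i<n. p i b z) - (\<Sum>i. p i b z)))"
        unfolding D_def
        by (subst sum.swap) (simp add: sum_subtractf scaleR_right_diff_distrib scaleR_sum_right)
      also have "norm \<dots> \<le> (\<Sum>b\<in>(Basis::'a set). norm h * (\<epsilon> / DIM('a)))"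
      proof (rule sum_norm_le)
        fix b :: 'a assume b: "b \<in> Basis"
        have "norm ((\<Sum>i<n. p i b z) - (\<Sum>i. p i b z)) \<le> \<epsilon> / DIM('a)"
          using tail[OF z b, of n] n by linarith
        then show "norm ((h \<bullet> b) *\<^sub>R ((\<Sum>i<n. p i b z) - (\<Sum>i. p i b z))) \<le> norm h * (\<epsilon> / DIM('a))"
          unfolding norm_scaleR by (intro mult_mono Basis_le_norm b) auto
      qed
      also have "\<dots> = \<epsilon> * norm h" by simp
      finally show "norm ((\<Sum>i<n. (\<Sum>b\<in>Basis. (h \<bullet> b) *\<^sub>R p i b z)) - D z h) \<le> \<epsilon> * norm h" .
    qed
  qed
  obtain g where g: "\<And>z. z \<in> S \<Longrightarrow> (\<lambda>n. u n z) sums g z"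
      "\<And>z. z \<in> S \<Longrightarrow> (g has_derivative D z) (at z within S)"
    using has_derivative_series[OF S(1) has_derivative_at_withinI[OF deriv] unif y f[OF y]] by blast
  have "(g has_derivative D y) (at y)"
    using g(2)[OF y] at_within_open[OF y S(2)] by simp
  then have "(f has_derivative D y) (at y)"
    by (rule has_derivative_transform_within_open[OF _ S(2) y]) (use f g(1) sums_unique2 in blast)
  then show ?thesis unfolding D_def .
qed

lemma summable_on_imp_norm_summable_on:
  fixes f :: "'i \<Rightarrow> 'b::euclidean_space"
  assumes "f summable_on A"
  shows "(\<lambda>i. norm (f i)) summable_on A"
proof -
  have "(\<lambda>i. \<bar>f i \<bullet> c\<bar>) summable_on A" for c
    using summable_on_bounded_linear[OF bounded_linear_inner_left assms, of c]
    unfolding real_norm_def[symmetric] by (rule summable_on_iff_abs_summable_on_real[THEN iffD1])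
  note comp = this
  have "(\<lambda>i. \<Sum>c\<in>B. \<bar>f i \<bullet> c\<bar>) summable_on A" if "finite B" for B
    using that by (induction B rule: finite_induct) (simp_all add: summable_on_add comp)
  from this[OF finite_Basis]
  show ?thesis
    by (rule summable_on_comparison_test) (simp_all add: norm_le_l1)
qed

text \<open>
  Convergence at the single point whose coordinates all exceed those of \<open>x\<close> by \<open>r\<close> already controls every
  coefficient, because unconditional summability in a Euclidean space is absolute.
\<close>

lemma power_series_at_point_imp_norm_summable:
  fixes a :: "('a::euclidean_space \<Rightarrow> nat) \<Rightarrow> 'b::euclidean_space"
  assumes "0 < \<epsilon>"
    and ser: "\<And>y. y \<in> ball x \<epsilon> \<Longrightarrow>
      ((\<lambda>\<alpha>. (\<Prod>b\<in>Basis. ((y - x) \<bullet> b) ^ \<alpha> b) *\<^sub>R a \<alpha>) has_sum f y) (Basis \<rightarrow>\<^sub>E UNIV)"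
  obtains r where "0 < r" "(\<lambda>\<alpha>. r ^ (\<Sum>b\<in>Basis. \<alpha> b) * norm (a \<alpha>)) summable_on (Basis \<rightarrow>\<^sub>E UNIV)"
proof -
  define r where "r = \<epsilon> / (2 * DIM('a))"
  have r: "0 < r" using assms by (simp add: r_def)
  define y where "y = x + (\<Sum>b\<in>Basis. r *\<^sub>R b)"
  have "norm (y - x) \<le> (\<Sum>b\<in>(Basis::'a set). r)"
    unfolding y_def add_diff_cancel_left' using r by (intro sum_norm_le) simp
  also have "\<dots> < \<epsilon>" using assms(1) by (simp add: r_def)
  finally have "y \<in> ball x \<epsilon>" by (simp add: dist_norm norm_minus_commute)
  then have "(\<lambda>\<alpha>. (\<Prod>b\<in>Basis. ((y - x) \<bullet> b) ^ \<alpha> b) *\<^sub>R a \<alpha>) summable_on (Basis \<rightarrow>\<^sub>E UNIV)"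
    using ser has_sum_imp_summable by blast
  from summable_on_imp_norm_summable_on[OF this]
  have "(\<lambda>\<alpha>. norm ((\<Prod>b\<in>Basis. ((y - x) \<bullet> b) ^ \<alpha> b) *\<^sub>R a \<alpha>)) summable_on (Basis \<rightarrow>\<^sub>E UNIV)" .
  moreover have "(\<Prod>b\<in>Basis. ((y - x) \<bullet> b) ^ \<alpha> b) = r ^ (\<Sum>b\<in>Basis. \<alpha> b)" for \<alpha>
    unfolding power_sum by (intro prod.cong refl) (simp add: y_def inner_sum_left_Basis)
  ultimately show ?thesis using r by (intro that[OF r]) simp
qed

lemma has_derivative_monomial:
  fixes x y :: "'a::euclidean_space"
  shows "((\<lambda>y. \<Prod>b\<in>Basis. ((y - x) \<bullet> b) ^ \<alpha> b) has_derivative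
    (\<lambda>h. \<Sum>b\<in>Basis. (h \<bullet> b) * (real (\<alpha> b) * (\<Prod>c\<in>Basis. ((y - x) \<bullet> c) ^ (\<alpha>(b := \<alpha> b - 1)) c))))
    (at y)"
proof -
  have "((\<lambda>y. \<Prod>b\<in>Basis. ((y - x) \<bullet> b) ^ \<alpha> b) has_derivative
    (\<lambda>h. \<Sum>b\<in>Basis. (real (\<alpha> b) * (h \<bullet> b) * ((y - x) \<bullet> b) ^ (\<alpha> b - 1)) *
        (\<Prod>c\<in>Basis - {b}. ((y - x) \<bullet> c) ^ \<alpha> c))) (at y)"
    by (rule has_derivative_prod, rule has_derivative_eq_rhs[OF has_derivative_power])
      (auto intro!: derivative_eq_intros simp: ac_simps)
  moreover
  have "(real (\<alpha> b) * (h \<bullet> b) * ((y - x) \<bullet> b) ^ (\<alpha> b - 1)) *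
        (\<Prod>c\<in>Basis - {b}. ((y - x) \<bullet> c) ^ \<alpha> c)
      = (h \<bullet> b) * (real (\<alpha> b) * (\<Prod>c\<in>Basis. ((y - x) \<bullet> c) ^ (\<alpha>(b := \<alpha> b - 1)) c))"
    if "b \<in> Basis" for h and b :: 'a
    using that by (subst (2) prod.remove[of _ b]) (auto intro!: prod.cong)
  then have "(\<lambda>h. \<Sum>b\<in>Basis. (real (\<alpha> b) * (h \<bullet> b) * ((y - x) \<bullet> b) ^ (\<alpha> b - 1)) *
        (\<Prod>c\<in>Basis - {b}. ((y - x) \<bullet> c) ^ \<alpha> c))
      = (\<lambda>h. \<Sum>b\<in>Basis. (h \<bullet> b) * (real (\<alpha> b) * (\<Prod>c\<in>Basis. ((y - x) \<bullet> c) ^ (\<alpha>(b := \<alpha> b - 1)) c)))"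
    by (intro ext sum.cong refl)
  ultimately show ?thesis by (rule has_derivative_eq_rhs)
qed

text \<open>
  The multi-indices form a countably infinite set; enumerating it turns an unordered sum into a series.
\<close>

lemma has_sum_multi_indices_imp_sums:
  fixes w :: "('a::euclidean_space \<Rightarrow> nat) \<Rightarrow> 'b::{topological_comm_monoid_add,t2_space}"
  assumes "(w has_sum l) (Basis \<rightarrow>\<^sub>E UNIV)"
  shows "(\<lambda>n. w (from_nat_into (Basis \<rightarrow>\<^sub>E UNIV) n)) sums l"
proof -
  let ?I = "Basis \<rightarrow>\<^sub>E (UNIV :: nat set) :: ('a \<Rightarrow> nat) set"
  obtain b0 :: 'a where b0: "b0 \<in> Basis" using nonempty_Basis by blast
  have "countable ?I" by (intro countable_PiE) auto
  moreover have "infinite ?I"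
  proof
    assume "finite ?I"
    then have "finite ((\<lambda>\<alpha>. \<alpha> b0) ` ?I)" by simp
    moreover have "n \<in> (\<lambda>\<alpha>. \<alpha> b0) ` ?I" for n
      by (rule image_eqI[of _ _ "restrict (\<lambda>_. n) Basis"]) (auto simp: b0)
    then have "(\<lambda>\<alpha>. \<alpha> b0) ` ?I = UNIV" by blast
    ultimately show False by (metis infinite_UNIV_nat)
  qed
  ultimately have "bij_betw (from_nat_into ?I) UNIV ?I"
    by (rule bij_betw_from_nat_into)
  then show ?thesis
    using assms has_sum_reindex_bij_betw[of "from_nat_into ?I" UNIV ?I w l] has_sum_imp_sums by blast
qed

text \<open>
  The terms of the series are differentiated one by one.  On the ball of half the radius given by
  \<open>power_series_at_point_imp_norm_summable\<close>, the derivatives are dominated by a multiple of the summable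
  bound \<open>r\<^sup>|\<^sup>\<alpha>\<^sup>| \<parallel>a\<^sub>\<alpha>\<parallel>\<close>.
\<close>

lemma power_series_has_derivative:
  fixes a :: "('a::euclidean_space \<Rightarrow> nat) \<Rightarrow> 'b::euclidean_space"
  assumes "0 < \<epsilon>"
    and ser: "\<And>y. y \<in> ball x \<epsilon> \<Longrightarrow>
      ((\<lambda>\<alpha>. (\<Prod>b\<in>Basis. ((y - x) \<bullet> b) ^ \<alpha> b) *\<^sub>R a \<alpha>) has_sum f y) (Basis \<rightarrow>\<^sub>E UNIV)"
  obtains \<delta> p where "0 < \<delta>" "\<delta> \<le> \<epsilon>"
    "\<And>y b. y \<in> ball x \<delta> \<Longrightarrow> b \<in> Basis \<Longrightarrow> 
      ((\<lambda>\<alpha>. (real (\<alpha> b) * (\<Prod>c\<in>Basis. ((y - x) \<bullet> c) ^ (\<alpha>(b := \<alpha> b - 1)) c)) *\<^sub>R a \<alpha>) has_sum p b y) (Basis \<rightarrow>\<^sub>E UNIV)"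
    "\<And>y. y \<in> ball x \<delta> \<Longrightarrow> (f has_derivative (\<lambda>h. \<Sum>b\<in>Basis. (h \<bullet> b) *\<^sub>R p b y)) (at y)"
proof -
  let ?I = "Basis \<rightarrow>\<^sub>E (UNIV :: nat set) :: ('a \<Rightarrow> nat) set"
  obtain r where r: "0 < r" and
    sumr: "(\<lambda>\<alpha>. r ^ (\<Sum>b\<in>Basis. \<alpha> b) * norm (a \<alpha>)) summable_on ?I"
    using power_series_at_point_imp_norm_summable[OF assms(1) ser] by blast
  define \<delta> where "\<delta> = min \<epsilon> (r / 2)"
  define q where "q \<alpha> b y = (real (\<alpha> b) * (\<Prod>c\<in>Basis. ((y - x) \<bullet> c) ^ (\<alpha>(b := \<alpha> b - 1)) c)) *\<^sub>R a \<alpha>"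
    for \<alpha> :: "'a \<Rightarrow> nat" and b y
  define M where "M \<alpha> = (2 / r) * (r ^ (\<Sum>b\<in>Basis. \<alpha> b) * norm (a \<alpha>))" for \<alpha> :: "'a \<Rightarrow> nat"
  have sumM: "M summable_on ?I"
    unfolding M_def by (intro summable_on_cmult_right sumr)
  \<comment> \<open>For \<open>\<bar>z\<^sub>c\<bar> \<le> r/2\<close> the factor \<open>\<alpha>\<^sub>b\<close> that differentiation produces is absorbed by \<open>2\<^sup>|\<^sup>\<alpha>\<^sup>|\<close>.\<close>
  have qM: "norm (q \<alpha> b y) \<le> M \<alpha>" if y: "y \<in> ball x \<delta>" and b: "b \<in> Basis" for \<alpha> b y
  proof (cases "\<alpha> b = 0")
    case True
    then show ?thesis using r by (simp add: q_def M_def)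
  next
    case False
    define N where "N = (\<Sum>b\<in>Basis. \<alpha> b)"
    have N: "(\<Sum>c\<in>Basis. (\<alpha>(b := \<alpha> b - 1)) c) = N - 1" and bN: "\<alpha> b \<le> N" 
    proof -
      have "N = \<alpha> b + (\<Sum>c\<in>Basis - {b}. \<alpha> c)" unfolding N_def using b by (simp add: sum.remove)
      moreover have "(\<Sum>c\<in>Basis. (\<alpha>(b := \<alpha> b - 1)) c) = (\<alpha> b - 1) + (\<Sum>c\<in>Basis - {b}. \<alpha> c)"
        using b by (subst sum.remove[of _ b]) (auto intro!: sum.cong)
      ultimately show "(\<Sum>c\<in>Basis. (\<alpha>(b := \<alpha> b - 1)) c) = N - 1" "\<alpha> b \<le> N" using False by auto
    qed
    have z: "\<bar>(y - x) \<bullet> c\<bar> \<le> r / 2" if "c \<in> Basis" for c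
      using y Basis_le_norm[OF that, of "y - x"] by (simp add: \<delta>_def dist_norm norm_minus_commute)
    have "\<bar>\<Prod>c\<in>Basis. ((y - x) \<bullet> c) ^ (\<alpha>(b := \<alpha> b - 1)) c\<bar>
        \<le> (\<Prod>c\<in>Basis. (r / 2) ^ (\<alpha>(b := \<alpha> b - 1)) c)"
      unfolding abs_prod power_abs by (intro prod_mono conjI power_mono z) auto
    also have "\<dots> = (r / 2) ^ (N - 1)" by (simp only: power_sum[symmetric] N)
    finally have m: "\<bar>\<Prod>c\<in>Basis. ((y - x) \<bullet> c) ^ (\<alpha>(b := \<alpha> b - 1)) c\<bar> \<le> (r / 2) ^ (N - 1)" .
    have "real (\<alpha> b) \<le> 2 ^ N"
      using bN of_nat_less_two_power[of N, where 'a = real] by linarith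
    with m have "real (\<alpha> b) * \<bar>\<Prod>c\<in>Basis. ((y - x) \<bullet> c) ^ (\<alpha>(b := \<alpha> b - 1)) c\<bar> \<le> 2 ^ N * (r / 2) ^ (N - 1)"
      by (intro mult_mono) auto
    also have "\<dots> = 2 / r * r ^ N"
      using bN False r by (cases N) (auto simp: power_divide)
    finally have "real (\<alpha> b) * \<bar>\<Prod>c\<in>Basis. ((y - x) \<bullet> c) ^ (\<alpha>(b := \<alpha> b - 1)) c\<bar> * norm (a \<alpha>)
        \<le> 2 / r * r ^ N * norm (a \<alpha>)"
      by (rule mult_right_mono) simp
    then show ?thesis
      unfolding q_def M_def N_def[symmetric] norm_scaleR abs_mult
      by (simp only: abs_of_nat mult.assoc)
  qed
  have qs: "(\<lambda>\<alpha>. q \<alpha> b y) summable_on ?I" if "y \<in> ball x \<delta>" "b \<in> Basis" for b y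
    by (rule abs_summable_summable, rule summable_on_comparison_test[OF sumM])
      (simp_all add: qM[OF that])
  let ?e = "from_nat_into ?I"
  note sumsI = has_sum_multi_indices_imp_sums
  have "summable (\<lambda>n. M (?e n))"
    using sumsI[OF has_sum_infsum[OF sumM]] by (rule sums_summable)
  then have der: "(f has_derivative (\<lambda>h. \<Sum>b\<in>Basis. (h \<bullet> b) *\<^sub>R (\<Sum>n. q (?e n) b y))) (at y)"
    if "y \<in> ball x \<delta>" for y
  proof (rule has_derivative_sums_of_partials[OF convex_ball open_ball that, rotated 2])
    show "(\<lambda>n. (\<Prod>b\<in>Basis. ((z - x) \<bullet> b) ^ (?e n) b) *\<^sub>R a (?e n)) sums f z" if "z \<in> ball x \<delta>" for z
      by (rule sumsI[OF ser]) (use that in \<open>simp add: \<delta>_def\<close>)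
    show "((\<lambda>z. (\<Prod>b\<in>Basis. ((z - x) \<bullet> b) ^ (?e n) b) *\<^sub>R a (?e n)) has_derivative
       (\<lambda>h. \<Sum>b\<in>Basis. (h \<bullet> b) *\<^sub>R q (?e n) b z)) (at z)" for n z
      unfolding q_def
      by (rule has_derivative_eq_rhs[OF has_derivative_scaleR_left[OF has_derivative_monomial]])
        (simp add: scaleR_sum_left)
  qed (rule qM)
  have "(\<Sum>n. q (?e n) b y) = (\<Sum>\<^sub>\<infinity>\<alpha>\<in>?I. q \<alpha> b y)" if "y \<in> ball x \<delta>" "b \<in> Basis" for b y
    using sumsI[OF has_sum_infsum[OF qs[OF that]]] by (simp add: sums_iff)
  then have "(\<lambda>h. \<Sum>b\<in>Basis. (h \<bullet> b) *\<^sub>R (\<Sum>n. q (?e n) b y))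
      = (\<lambda>h. \<Sum>b\<in>Basis. (h \<bullet> b) *\<^sub>R (\<Sum>\<^sub>\<infinity>\<alpha>\<in>?I. q \<alpha> b y))" if "y \<in> ball x \<delta>" for y
    using that by (intro ext sum.cong refl) simp
  with der have "(f has_derivative (\<lambda>h. \<Sum>b\<in>Basis. (h \<bullet> b) *\<^sub>R (\<Sum>\<^sub>\<infinity>\<alpha>\<in>?I. q \<alpha> b y))) (at y)"
    if "y \<in> ball x \<delta>" for y
    using that by simp
  moreover have "0 < \<delta>" "\<delta> \<le> \<epsilon>" using r assms(1) by (auto simp: \<delta>_def)
  moreover have "((\<lambda>\<alpha>. q \<alpha> b y) has_sum (\<Sum>\<^sub>\<infinity>\<alpha>\<in>?I. q \<alpha> b y)) ?I" if "y \<in> ball x \<delta>" "b \<in> Basis" for b y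
    using qs[OF that] by (rule has_sum_infsum)
  ultimately show ?thesis
    unfolding q_def by (intro that[of \<delta> "\<lambda>b y. \<Sum>\<^sub>\<infinity>\<alpha>\<in>?I. q \<alpha> b y"]) (simp_all only: q_def)
qed

text \<open>
  The derivative of a power series with respect to the coordinate \<open>b\<close>, brought back to the form of a power
  series: the substitution \<open>\<alpha> = \<beta> + 1\<^sub>b\<close> reaches exactly the terms that do not vanish.
\<close>

lemma has_sum_shift_multi_index:
  fixes a :: "('a::euclidean_space \<Rightarrow> nat) \<Rightarrow> 'b::real_normed_vector"
  assumes b: "b \<in> Basis"
    and sum: "((\<lambda>\<alpha>. (real (\<alpha> b) * (\<Prod>c\<in>Basis. (z \<bullet> c) ^ (\<alpha>(b := \<alpha> b - 1)) c)) *\<^sub>R a \<alpha>) has_sum l)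
      (Basis \<rightarrow>\<^sub>E UNIV)"
  shows "((\<lambda>\<beta>. (\<Prod>c\<in>Basis. (z \<bullet> c) ^ \<beta> c) *\<^sub>R (real (Suc (\<beta> b)) *\<^sub>R a (\<beta>(b := Suc (\<beta> b))))) has_sum l)
      (Basis \<rightarrow>\<^sub>E UNIV)"
proof -
  let ?I = "Basis \<rightarrow>\<^sub>E (UNIV :: nat set) :: ('a \<Rightarrow> nat) set"
  let ?J = "{\<alpha> \<in> ?I. \<alpha> b \<noteq> 0}"
  let ?F = "\<lambda>\<alpha>. (real (\<alpha> b) * (\<Prod>c\<in>Basis. (z \<bullet> c) ^ (\<alpha>(b := \<alpha> b - 1)) c)) *\<^sub>R a \<alpha>"
  have "(?F has_sum l) ?I \<longleftrightarrow> (?F has_sum l) ?J"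
    by (rule has_sum_cong_neutral) auto
  with sum have J: "(?F has_sum l) ?J" by blast
  have bij: "bij_betw (\<lambda>\<beta>. \<beta>(b := Suc (\<beta> b))) ?I ?J"
    by (rule bij_betwI[where g = "\<lambda>\<alpha>. \<alpha>(b := \<alpha> b - 1)"])
      (use b in \<open>auto simp: PiE_iff extensional_def\<close>)
  have "((\<lambda>\<beta>. ?F (\<beta>(b := Suc (\<beta> b)))) has_sum l) ?I"
    using J by (subst has_sum_reindex_bij_betw[OF bij])
  then show ?thesis
    by (simp add: mult.commute)
qed

text \<open>
  The partial derivatives are analytic with the same centre, so that the lemma can be applied to them again;
  this is how second derivatives of the loop multiplication are obtained.
\<close>

lemma real_analytic_on_has_analytic_partials:
  fixes f :: "'a::euclidean_space \<Rightarrow> 'b::euclidean_space"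
  assumes f: "real_analytic_on f S"
  shows "\<exists>D. (\<forall>b\<in>Basis. real_analytic_on (D b) S) \<and>
    (\<forall>x\<in>S. (f has_derivative (\<lambda>h. \<Sum>b\<in>Basis. (h \<bullet> b) *\<^sub>R D b x)) (at x))"
proof -
  define D where "D b y = frechet_derivative f (at y) b" for b y
  have expansion: "\<exists>\<delta>>0. (\<forall>b\<in>Basis. \<exists>a. \<forall>y\<in>ball x \<delta>.
      ((\<lambda>\<alpha>. (\<Prod>c\<in>Basis. ((y - x) \<bullet> c) ^ \<alpha> c) *\<^sub>R a \<alpha>) has_sum D b y) (Basis \<rightarrow>\<^sub>E UNIV)) \<and>
      (f has_derivative (\<lambda>h. \<Sum>b\<in>Basis. (h \<bullet> b) *\<^sub>R D b x)) (at x)" if xS: "x \<in> S" for x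
  proof -
    obtain \<epsilon> a where "0 < \<epsilon>" and ser: "\<And>y. y \<in> ball x \<epsilon> \<Longrightarrow>
      ((\<lambda>\<alpha>. (\<Prod>b\<in>Basis. ((y - x) \<bullet> b) ^ \<alpha> b) *\<^sub>R a \<alpha>) has_sum f y) (Basis \<rightarrow>\<^sub>E UNIV)"
    proof -
      have "\<exists>\<epsilon>>0. \<exists>a :: ('a \<Rightarrow> nat) \<Rightarrow> 'b. \<forall>y\<in>ball x \<epsilon>.
          ((\<lambda>\<alpha>. (\<Prod>b\<in>Basis. ((y - x) \<bullet> b) ^ \<alpha> b) *\<^sub>R a \<alpha>) has_sum f y) (Basis \<rightarrow>\<^sub>E UNIV)"
        using f xS unfolding real_analytic_on_def by (rule bspec)
      then show thesis using that by blast
    qed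
    obtain \<delta> p where \<delta>: "0 < \<delta>" and
      p: "\<And>y b. y \<in> ball x \<delta> \<Longrightarrow> b \<in> Basis \<Longrightarrow>
        ((\<lambda>\<alpha>. (real (\<alpha> b) * (\<Prod>c\<in>Basis. ((y - x) \<bullet> c) ^ (\<alpha>(b := \<alpha> b - 1)) c)) *\<^sub>R a \<alpha>) has_sum p b y)
          (Basis \<rightarrow>\<^sub>E UNIV)"
      and der: "\<And>y. y \<in> ball x \<delta> \<Longrightarrow> (f has_derivative (\<lambda>h. \<Sum>b\<in>Basis. (h \<bullet> b) *\<^sub>R p b y)) (at y)"
      by (rule power_series_has_derivative[OF \<open>0 < \<epsilon>\<close> ser]) (assumption, rule that)
    have Dp: "D b y = p b y" if "y \<in> ball x \<delta>" "b \<in> Basis" for b y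
    proof -
      have "D b y = (\<Sum>c\<in>Basis. (b \<bullet> c) *\<^sub>R p c y)"
        unfolding D_def by (simp only: frechet_derivative_at[OF der[OF that(1)], symmetric])
      also have "\<dots> = (\<Sum>c\<in>Basis. if c = b then p c y else 0)"
        by (intro sum.cong refl) (use that in \<open>simp add: inner_Basis\<close>)
      finally show ?thesis using that by simp
    qed
    have "(\<lambda>h. \<Sum>b\<in>Basis. (h \<bullet> b) *\<^sub>R p b x) = (\<lambda>h. \<Sum>b\<in>Basis. (h \<bullet> b) *\<^sub>R D b x)"
      using Dp \<delta> by (intro ext sum.cong) auto
    then have "(f has_derivative (\<lambda>h. \<Sum>b\<in>Basis. (h \<bullet> b) *\<^sub>R D b x)) (at x)"
      using der[of x] \<delta> by simp
    moreover have "\<exists>a. \<forall>y\<in>ball x \<delta>.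
      ((\<lambda>\<alpha>. (\<Prod>c\<in>Basis. ((y - x) \<bullet> c) ^ \<alpha> c) *\<^sub>R a \<alpha>) has_sum D b y) (Basis \<rightarrow>\<^sub>E UNIV)"
      if b: "b \<in> Basis" for b
      by (intro exI ballI) (subst Dp[OF _ b], assumption, erule has_sum_shift_multi_index[OF b p[OF _ b]])
    ultimately show ?thesis using \<delta> by (intro exI[of _ \<delta>] conjI ballI)
  qed
  have "real_analytic_on (D b) S" if b: "b \<in> Basis" for b
    unfolding real_analytic_on_def
  proof
    fix x assume "x \<in> S"
    from expansion[OF this] b show "\<exists>\<epsilon>>0. \<exists>a :: ('a \<Rightarrow> nat) \<Rightarrow> 'b. \<forall>y\<in>ball x \<epsilon>.
        ((\<lambda>\<alpha>. (\<Prod>c\<in>Basis. ((y - x) \<bullet> c) ^ \<alpha> c) *\<^sub>R a \<alpha>) has_sum D b y) (Basis \<rightarrow>\<^sub>E UNIV)"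
      by (elim exE conjE) (rule exI, rule conjI, assumption, erule (1) bspec)
  qed
  moreover have "(f has_derivative (\<lambda>h. \<Sum>b\<in>Basis. (h \<bullet> b) *\<^sub>R D b x)) (at x)" if "x \<in> S" for x
    using expansion[OF that] by (elim exE conjE)
  ultimately show ?thesis by blast
qed

corollary real_analytic_on_imp_differentiable:
  assumes "real_analytic_on f S" "x \<in> S"
  shows "f differentiable (at x)"
  using real_analytic_on_has_analytic_partials[OF assms(1)] assms(2) unfolding differentiable_def by blast

section \<open>Symmetry of mixed second derivatives\<close>

text \<open>
  One half of the classical symmetry argument: the second difference of \<open>f\<close> along \<open>a\<close> and \<open>b\<close> is the
  increment over \<open>[0, t]\<close> of \<open>u \<mapsto> f (x + u a + t b) - f (x + u a)\<close>, whose derivative is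
  \<open>t A b + o(t)\<close> by the differentiability of \<open>y \<mapsto> f' y a\<close> at the one point \<open>x\<close>.
\<close>

lemma second_difference_quotient_bound:
  fixes f :: "'a::real_normed_vector \<Rightarrow> 'b::real_normed_vector"
  assumes U: "open U" "x \<in> U"
    and f: "\<And>y. y \<in> U \<Longrightarrow> (f has_derivative f' y) (at y)"
    and A: "((\<lambda>y. f' y a) has_derivative A) (at x)"
    and "0 < \<epsilon>"
  obtains d where "0 < d" "\<And>t. 0 < t \<Longrightarrow> t < d \<Longrightarrow>
    norm (f (x + t *\<^sub>R a + t *\<^sub>R b) - f (x + t *\<^sub>R a) - f (x + t *\<^sub>R b) + f x - (t * t) *\<^sub>R A b) \<le> \<epsilon> * (t * t)"
proof -
  define K where "K = norm a + norm b + 1"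
  have K: "0 < K" by (simp add: K_def add_nonneg_pos)
  have linA: "bounded_linear A" using A by (rule has_derivative_bounded_linear)
  interpret A: bounded_linear A by (rule linA)
  obtain \<rho> where \<rho>: "0 < \<rho>" "ball x \<rho> \<subseteq> U" using U openE by blast
  have "0 < \<epsilon> / (2 * K)" using \<open>0 < \<epsilon>\<close> K by simp
  then obtain d' where d': "0 < d'" and
    small: "\<And>y. norm (y - x) < d' \<Longrightarrow> norm (f' y a - f' x a - A (y - x)) \<le> \<epsilon> / (2 * K) * norm (y - x)"
    using A unfolding has_derivative_at_alt by blast
  define d where "d = min \<rho> d' / K"
  show ?thesis
  proof (rule that)
    show "0 < d" using \<rho> d' K by (simp add: d_def)
    fix t assume t: "0 < t" "t < d"
    have tK: "K * t < \<rho>" "K * t < d'"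
      using t K by (auto simp: d_def pos_less_divide_eq mult.commute)
    have near: "norm (u *\<^sub>R a + s *\<^sub>R b) \<le> K * t" if "0 \<le> u" "u \<le> t" "0 \<le> s" "s \<le> t" for u s
    proof -
      have "norm (u *\<^sub>R a + s *\<^sub>R b) \<le> u * norm a + s * norm b"
        using that by (intro order_trans[OF norm_triangle_ineq]) simp
      also have "\<dots> \<le> t * norm a + t * norm b"
        using that by (intro add_mono mult_right_mono) auto
      also have "\<dots> \<le> K * t" using t by (simp add: K_def algebra_simps)
      finally show ?thesis .
    qed
    have inU: "x + u *\<^sub>R a + s *\<^sub>R b \<in> U" if "0 \<le> u" "u \<le> t" "0 \<le> s" "s \<le> t" for u s
      using near[OF that] tK(1) \<rho>(2) by (auto simp: dist_norm norm_minus_commute algebra_simps subset_iff)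
    have approx: "norm (f' (x + u *\<^sub>R a + s *\<^sub>R b) a - f' x a - A (u *\<^sub>R a + s *\<^sub>R b)) \<le> \<epsilon> / 2 * t"
      if "0 \<le> u" "u \<le> t" "0 \<le> s" "s \<le> t" for u s
    proof -
      have "norm (f' (x + u *\<^sub>R a + s *\<^sub>R b) a - f' x a - A (u *\<^sub>R a + s *\<^sub>R b))
          \<le> \<epsilon> / (2 * K) * norm (u *\<^sub>R a + s *\<^sub>R b)"
        using small[of "x + u *\<^sub>R a + s *\<^sub>R b"] near[OF that] tK(2) by (simp add: add.assoc)
      also have "\<dots> \<le> \<epsilon> / (2 * K) * (K * t)"
        using near[OF that] \<open>0 < \<epsilon>\<close> K by (intro mult_left_mono) auto
      finally show ?thesis using K by simp
    qed
    \<comment> \<open>The term \<open>u t A b\<close> is subtracted so that the mean value inequality bounds the whole error.\<close>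
    define \<phi> where "\<phi> u = f (x + u *\<^sub>R a + t *\<^sub>R b) - f (x + u *\<^sub>R a) - (u * t) *\<^sub>R A b" for u
    define \<phi>' where "\<phi>' u = f' (x + u *\<^sub>R a + t *\<^sub>R b) a - f' (x + u *\<^sub>R a + 0 *\<^sub>R b) a - t *\<^sub>R A b" for u
    have der: "(\<phi> has_derivative (\<lambda>h. h *\<^sub>R \<phi>' u)) (at u within {0..t})" if "u \<in> {0..t}" for u
    proof -
      have lin: "f' y (h *\<^sub>R a) = h *\<^sub>R f' y a" if "y \<in> U" for y h
        using f[OF that] by (simp add: has_derivative_bounded_linear linear_cmul bounded_linear.linear)
      have 1: "x + u *\<^sub>R a + t *\<^sub>R b \<in> U" "x + u *\<^sub>R a \<in> U"
        using inU[of u t] inU[of u 0] that t by auto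
      have "(\<phi> has_derivative (\<lambda>h. f' (x + u *\<^sub>R a + t *\<^sub>R b) (h *\<^sub>R a) - f' (x + u *\<^sub>R a) (h *\<^sub>R a) - (h * t) *\<^sub>R A b))
          (at u within {0..t})"
        unfolding \<phi>_def
        by (intro has_derivative_diff
            has_derivative_compose[where g = f and f = "\<lambda>u. x + u *\<^sub>R a + t *\<^sub>R b", OF _ f[OF 1(1)]]
            has_derivative_compose[where g = f and f = "\<lambda>u. x + u *\<^sub>R a", OF _ f[OF 1(2)]])
          (auto intro!: derivative_eq_intros)
      then show ?thesis
        by (rule has_derivative_eq_rhs) (simp add: \<phi>'_def lin 1 scaleR_right_diff_distrib)
    qed
    have "norm (\<phi> t - \<phi> 0) \<le> (\<epsilon> * t) * norm (t - 0)"
    proof (rule differentiable_bound[OF convex_closed_interval der])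
      fix u assume u: "u \<in> {0..t}"
      have "\<phi>' u = (f' (x + u *\<^sub>R a + t *\<^sub>R b) a - f' x a - A (u *\<^sub>R a + t *\<^sub>R b))
          - (f' (x + u *\<^sub>R a + 0 *\<^sub>R b) a - f' x a - A (u *\<^sub>R a + 0 *\<^sub>R b))"
        by (simp add: \<phi>'_def A.add A.scaleR)
      also have "norm \<dots> \<le> \<epsilon> / 2 * t + \<epsilon> / 2 * t"
        using u t by (intro order_trans[OF norm_triangle_ineq4] add_mono approx) auto
      finally have "norm (\<phi>' u) \<le> \<epsilon> * t" by simp
      then show "onorm (\<lambda>h. h *\<^sub>R \<phi>' u) \<le> \<epsilon> * t"
        by (intro onorm_le) (simp add: mult.commute[of "\<epsilon> * t"] mult_left_mono)
    qed (use t in auto)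
    moreover have "\<phi> t - \<phi> 0 = f (x + t *\<^sub>R a + t *\<^sub>R b) - f (x + t *\<^sub>R a) - f (x + t *\<^sub>R b) + f x - (t * t) *\<^sub>R A b"
      by (simp add: \<phi>_def)
    ultimately show "norm (f (x + t *\<^sub>R a + t *\<^sub>R b) - f (x + t *\<^sub>R a) - f (x + t *\<^sub>R b) + f x - (t * t) *\<^sub>R A b)
        \<le> \<epsilon> * (t * t)"
      using t by (simp add: mult.assoc)
  qed
qed

text \<open>
  The second difference is symmetric in \<open>a\<close> and \<open>b\<close>, so its two approximations \<open>t\<^sup>2 A b\<close> and \<open>t\<^sup>2 B a\<close>
  must agree.  Continuity of the second derivatives is replaced by differentiability of the first ones at
  \<open>x\<close>, which is all that the Lie equations provide.
\<close>

lemma mixed_derivatives_symmetric: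
  fixes f :: "'a::real_normed_vector \<Rightarrow> 'b::real_normed_vector"
  assumes U: "open U" "x \<in> U"
    and f: "\<And>y. y \<in> U \<Longrightarrow> (f has_derivative f' y) (at y)"
    and A: "((\<lambda>y. f' y a) has_derivative A) (at x)"
    and B: "((\<lambda>y. f' y b) has_derivative B) (at x)"
  shows "A b = B a"
proof (rule ccontr)
  assume neq: "A b \<noteq> B a"
  define \<epsilon> where "\<epsilon> = norm (A b - B a) / 3"
  have \<epsilon>: "0 < \<epsilon>" using neq by (simp add: \<epsilon>_def)
  obtain d1 where d1: "0 < d1" and q1: "\<And>t. 0 < t \<Longrightarrow> t < d1 \<Longrightarrow>
    norm (f (x + t *\<^sub>R a + t *\<^sub>R b) - f (x + t *\<^sub>R a) - f (x + t *\<^sub>R b) + f x - (t * t) *\<^sub>R A b) \<le> \<epsilon> * (t * t)"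
    by (rule second_difference_quotient_bound[OF U f A \<epsilon>, of b]) blast+
  obtain d2 where d2: "0 < d2" and q2: "\<And>t. 0 < t \<Longrightarrow> t < d2 \<Longrightarrow>
    norm (f (x + t *\<^sub>R b + t *\<^sub>R a) - f (x + t *\<^sub>R b) - f (x + t *\<^sub>R a) + f x - (t * t) *\<^sub>R B a) \<le> \<epsilon> * (t * t)"
    by (rule second_difference_quotient_bound[OF U f B \<epsilon>, of a]) blast+
  define t where "t = min d1 d2 / 2"
  have t: "0 < t" "t < d1" "t < d2" using d1 d2 by (auto simp: t_def)
  let ?\<Delta> = "f (x + t *\<^sub>R a + t *\<^sub>R b) - f (x + t *\<^sub>R a) - f (x + t *\<^sub>R b) + f x"
  have 1: "norm (?\<Delta> - (t * t) *\<^sub>R A b) \<le> \<epsilon> * (t * t)" using q1 t by blast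
  have eq: "f (x + t *\<^sub>R b + t *\<^sub>R a) - f (x + t *\<^sub>R b) - f (x + t *\<^sub>R a) + f x = ?\<Delta>"
    by (simp add: add.assoc add.commute[of "t *\<^sub>R a"])
  have 2: "norm (?\<Delta> - (t * t) *\<^sub>R B a) \<le> \<epsilon> * (t * t)" using q2[OF t(1,3)] unfolding eq .
  have "(t * t) *\<^sub>R (A b - B a) = (?\<Delta> - (t * t) *\<^sub>R B a) - (?\<Delta> - (t * t) *\<^sub>R A b)"
    by (simp add: algebra_simps)
  also have "norm \<dots> \<le> \<epsilon> * (t * t) + \<epsilon> * (t * t)"
    by (intro order_trans[OF norm_triangle_ineq4] add_mono 1 2)
  finally have "(t * t) * norm (A b - B a) \<le> (t * t) * (2 * \<epsilon>)"
    unfolding norm_scaleR by (simp add: ac_simps)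
  then have "norm (A b - B a) \<le> 2 * \<epsilon>" using t by (simp add: mult_le_cancel_left)
  then show False using \<epsilon> by (simp add: \<epsilon>_def)
qed

section \<open>Differentiable matrix-valued functions\<close>

lemma bounded_bilinear_matrix_mult:
  "bounded_bilinear ((**) :: 'k::real_normed_field^'n::finite^'m::finite \<Rightarrow> 'k^'p::finite^'n \<Rightarrow> 'k^'p^'m)"
proof
  fix A A' :: "'k^'n^'m" and B B' :: "'k^'p^'n" and r :: real
  show "(A + A') ** B = A ** B + A' ** B"
    by (simp add: vec_eq_iff matrix_matrix_mult_def distrib_right sum.distrib)
  show "A ** (B + B') = A ** B + A ** B'"
    by (simp add: vec_eq_iff matrix_matrix_mult_def distrib_left sum.distrib)
  show "(r *\<^sub>R A) ** B = r *\<^sub>R (A ** B)" "A ** (r *\<^sub>R B) = r *\<^sub>R (A ** B)"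
    by (simp_all add: vec_eq_iff matrix_matrix_mult_def scaleR_sum_right)
  have entry: "norm (M $ i $ j) \<le> norm M" for M :: "'k^'q::finite^'s::finite" and i j
    by (rule order_trans[OF Finite_Cartesian_Product.norm_nth_le Finite_Cartesian_Product.norm_nth_le])
  show "\<exists>K. \<forall>A B. norm ((A :: 'k^'n^'m) ** (B :: 'k^'p^'n)) \<le> norm A * norm B * K"
  proof (intro exI allI)
    fix A :: "'k^'n^'m" and B :: "'k^'p^'n"
    have "norm ((A ** B) $ i $ j) \<le> (\<Sum>k\<in>(UNIV::'n set). norm A * norm B)" for i j
      unfolding matrix_matrix_mult_def vec_lambda_beta
      by (intro sum_norm_le order_trans[OF norm_mult_ineq] mult_mono entry) auto
    then have "norm ((A ** B) $ i) \<le> (\<Sum>j\<in>(UNIV::'p set). \<Sum>k\<in>(UNIV::'n set). norm A * norm B)" for i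
      unfolding norm_vec_def[of "(A ** B) $ i"] by (intro order_trans[OF L2_set_le_sum] sum_mono) auto
    then have "norm (A ** B) \<le> (\<Sum>i\<in>(UNIV::'m set). \<Sum>j\<in>(UNIV::'p set). \<Sum>k\<in>(UNIV::'n set). norm A * norm B)"
      unfolding norm_vec_def[of "A ** B"] by (intro order_trans[OF L2_set_le_sum] sum_mono) auto
    also have "\<dots> = norm A * norm B * (CARD('m) * (CARD('p) * CARD('n)))"
      by simp
    finally show "norm (A ** B) \<le> norm A * norm B * (CARD('m) * (CARD('p) * CARD('n)))" .
  qed
qed

lemmas has_derivative_matrix_mult [derivative_intros] =
  bounded_bilinear.FDERIV[OF bounded_bilinear_matrix_mult]

lemma matrix_inv_left_right:
  fixes A :: "'k::field^'n::finite^'n"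
  assumes "invertible A"
  shows "A ** matrix_inv A = mat 1" "matrix_inv A ** A = mat 1"
  using someI_ex[OF assms[unfolded invertible_def]] by (simp_all add: matrix_inv_def)

text \<open>
  A bounded factor does not spoil a vanishing derivative at a zero.  Boundedness is
  all that is known of the matrix inverse at the point where this is applied.
\<close>

lemma has_derivative_bounded_matrix_mult_small:
  fixes R Q :: "'a::real_normed_vector \<Rightarrow> 'k::real_normed_field^'n::finite^'n"
  assumes Q: "(Q has_derivative (\<lambda>_. 0)) (at x)" "Q x = 0"
    and R: "eventually (\<lambda>y. norm (R y) \<le> C) (at x)"
  shows "((\<lambda>y. R y ** Q y) has_derivative (\<lambda>_. 0)) (at x)"
proof -
  obtain K where K: "0 < K" "\<And>(A::'k^'n^'n) (B::'k^'n^'n). norm (A ** B) \<le> norm A * norm B * K"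
    using bounded_bilinear.pos_bounded[OF bounded_bilinear_matrix_mult] by blast
  define C' where "C' = max C 1"
  have C': "0 < C'" by (simp add: C'_def)
  have "eventually (\<lambda>y. norm (R y ** Q y) \<le> \<epsilon> * norm (y - x)) (at x)" if "0 < \<epsilon>" for \<epsilon>
  proof -
    have "0 < \<epsilon> / (C' * K)" using that K by (simp add: C'_def)
    moreover have "\<forall>\<epsilon>>0. eventually (\<lambda>y. norm (Q y) \<le> \<epsilon> * norm (y - x)) (at x)"
      using Q unfolding has_derivative_within_alt2 by simp
    ultimately have "eventually (\<lambda>y. norm (Q y) \<le> \<epsilon> / (C' * K) * norm (y - x)) (at x)"
      by blast
    with R show ?thesis
    proof eventually_elim
      case (elim y)
      have "norm (R y ** Q y) \<le> norm (R y) * norm (Q y) * K" by (rule K)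
      also have "\<dots> \<le> C' * (\<epsilon> / (C' * K) * norm (y - x)) * K"
        using elim K that by (intro mult_mono) (auto simp: C'_def)
      also have "\<dots> = \<epsilon> * norm (y - x)" using K C' by simp
      finally show ?case .
    qed
  qed
  then show ?thesis unfolding has_derivative_within_alt2 using Q(2)
    by (simp add: bounded_bilinear.zero_right[OF bounded_bilinear_matrix_mult])
qed

interpretation matrix_mult: bounded_bilinear "(**) :: 'k::real_normed_field^'n::finite^'m::finite \<Rightarrow> 'k^'p::finite^'n \<Rightarrow> 'k^'p^'m"
  by (rule bounded_bilinear_matrix_mult)

text \<open>
  The field of scalars is not assumed complete, so there is no Neumann series.  Instead, with \<open>R = A\<^sup>-\<^sup>1\<close>
  and \<open>P = A - A(x)\<close>, the resolvent identity \<open>R(y) = R(x) - R(y) P(y) R(x)\<close> first shows that \<open>R\<close> is bounded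
  near \<open>x\<close>, and its iteration exhibits \<open>R(y) - R(x) + R(x) P(y) R(x)\<close> as a bounded factor times a term of
  second order.
\<close>

lemma has_derivative_matrix_inv:
  fixes A :: "'a::real_normed_vector \<Rightarrow> 'k::real_normed_field^'n::finite^'n"
  assumes A: "(A has_derivative A') (at x)"
    and inv: "eventually (\<lambda>y. invertible (A y)) (at x)" "invertible (A x)"
  shows "((\<lambda>y. matrix_inv (A y)) has_derivative
    (\<lambda>h. - (matrix_inv (A x) ** A' h ** matrix_inv (A x)))) (at x)"
proof -
  define R where "R y = matrix_inv (A y)" for y
  define P where "P y = A y - A x" for y
  obtain K where K: "0 < K" "\<And>(A::'k^'n^'n) (B::'k^'n^'n). norm (A ** B) \<le> norm A * norm B * K"
    using matrix_mult.pos_bounded by blast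
  have R: "A y ** R y = mat 1" "R y ** A y = mat 1" if "invertible (A y)" for y
    unfolding R_def using matrix_inv_left_right[OF that] .
  have diff: "R y = R x - R y ** (P y ** R x)" if y: "invertible (A y)" for y
  proof -
    have "R y ** (P y ** R x) = (R y ** A y) ** R x - R y ** (A x ** R x)"
      by (simp add: P_def matrix_mult.diff_left matrix_mult.diff_right matrix_mul_assoc)
    then show ?thesis by (simp add: R y inv(2))
  qed
  have P: "(P has_derivative A') (at x)" "P x = 0"
    unfolding P_def using A by (auto intro!: derivative_eq_intros)
  have "((\<lambda>y. norm (P y ** R x)) \<longlongrightarrow> norm (P x ** R x)) (at x)"
    by (intro tendsto_intros matrix_mult.tendsto has_derivative_continuous[OF P(1), unfolded continuous_within])
  then have "eventually (\<lambda>y. norm (P y ** R x) < 1 / (2 * K)) (at x)"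
    by (rule order_tendstoD) (use K P(2) in simp)
  then have bound: "eventually (\<lambda>y. norm (R y) \<le> 2 * norm (R x)) (at x)"
    using inv(1)
  proof eventually_elim
    case (elim y)
    have "norm (R y) \<le> norm (R x) + norm (R y ** (P y ** R x))"
      using norm_triangle_ineq4[of "R x" "R y ** (P y ** R x)"] diff[OF elim(2)] by simp
    also have "norm (R y ** (P y ** R x)) \<le> norm (R y) * norm (P y ** R x) * K" by (rule K)
    also have "\<dots> \<le> norm (R y) * (1 / (2 * K)) * K"
      using elim(1) K by (intro mult_mono) auto
    finally show ?case using K by simp
  qed
  let ?Q = "\<lambda>y. P y ** R x ** (P y ** R x)"
  have remainder: "((\<lambda>y. R y ** ?Q y) has_derivative (\<lambda>_. 0)) (at x)"
    by (rule has_derivative_bounded_matrix_mult_small[OF _ _ bound])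
      (auto intro!: derivative_eq_intros P(1) simp: P(2))
  have main: "((\<lambda>y. R x - R x ** P y ** R x) has_derivative (\<lambda>h. - (R x ** A' h ** R x))) (at x)"
    by (auto intro!: derivative_eq_intros P(1))
  have "((\<lambda>y. R x - R x ** P y ** R x + R y ** ?Q y) has_derivative (\<lambda>h. - (R x ** A' h ** R x))) (at x)"
    by (rule has_derivative_eq_rhs[OF has_derivative_add[OF main remainder]]) simp
  moreover have "eventually (\<lambda>y. R x - R x ** P y ** R x + R y ** ?Q y = R y) (at x)"
    using inv(1)
  proof eventually_elim
    case (elim y)
    have "R y = R x - (R x - R y ** (P y ** R x)) ** (P y ** R x)"
      using diff[OF elim] by simp
    also have "\<dots> = R x - R x ** P y ** R x + R y ** ?Q y"
      by (simp add: matrix_mult.diff_left matrix_mul_assoc)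
    finally show ?case by (rule sym)
  qed
  ultimately have "(R has_derivative (\<lambda>h. - (R x ** A' h ** R x))) (at x)"
    by (rule has_derivative_transform_eventually) (simp_all add: P(2))
  then show ?thesis unfolding R_def .
qed

text \<open>
  Since \<open>A(t)\<close> and \<open>B(t)\<close> commute exactly when \<open>A(t) - 1\<close> and \<open>B(t) - 1\<close> do, dividing by \<open>t\<^sup>2\<close> and letting
  \<open>t\<close> tend to \<open>0\<close> gives a second-order conclusion from first derivatives only.
\<close>

lemma commuting_curves_imp_commuting_velocities:
  fixes A B :: "real \<Rightarrow> 'k::real_normed_field^'n::finite^'n"
  assumes A: "(A has_vector_derivative a) (at 0)" "A 0 = mat 1"
    and B: "(B has_vector_derivative b) (at 0)" "B 0 = mat 1"
    and comm: "\<And>t. A t ** B t = B t ** A t"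
  shows "a ** b = b ** a"
proof -
  have quot: "((\<lambda>t. (C t - mat 1) /\<^sub>R t) \<longlongrightarrow> c) (at 0)"
    if "(C has_vector_derivative c) (at 0)" "C 0 = mat 1" for C :: "real \<Rightarrow> 'k^'n^'n" and c
  proof -
    have "((\<lambda>t. norm (C t - C 0 - (t - 0) *\<^sub>R c) / norm (t - 0)) \<longlongrightarrow> 0) (at 0)"
      using that(1) unfolding has_vector_derivative_def has_derivative_iff_norm by blast
    moreover have "norm (C t - C 0 - (t - 0) *\<^sub>R c) / norm (t - 0) = norm ((C t - mat 1) /\<^sub>R t - c)"
      if "t \<noteq> 0" for t
    proof -
      have "(C t - mat 1) /\<^sub>R t - c = (C t - C 0 - (t - 0) *\<^sub>R c) /\<^sub>R t"
        using that \<open>C 0 = mat 1\<close> by (simp add: scaleR_diff_right)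
      then show ?thesis by (simp add: divide_inverse mult.commute)
    qed
    ultimately have "((\<lambda>t. norm ((C t - mat 1) /\<^sub>R t - c)) \<longlongrightarrow> 0) (at 0)"
      by (simp cong: Lim_cong_within)
    then show ?thesis
      using Lim_null tendsto_norm_zero_iff by blast
  qed
  have "((\<lambda>t. ((A t - mat 1) /\<^sub>R t) ** ((B t - mat 1) /\<^sub>R t)) \<longlongrightarrow> a ** b) (at 0)"
    by (intro matrix_mult.tendsto quot A B)
  moreover have "((\<lambda>t. ((B t - mat 1) /\<^sub>R t) ** ((A t - mat 1) /\<^sub>R t)) \<longlongrightarrow> b ** a) (at 0)"
    by (intro matrix_mult.tendsto quot A B)
  moreover have "(A t - mat 1) ** (B t - mat 1) = (B t - mat 1) ** (A t - mat 1)" for t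
    by (simp add: matrix_mult.diff_left matrix_mult.diff_right comm)
  then have "((A t - mat 1) /\<^sub>R t) ** ((B t - mat 1) /\<^sub>R t) = ((B t - mat 1) /\<^sub>R t) ** ((A t - mat 1) /\<^sub>R t)" for t
    by (simp add: matrix_mult.scaleR_left matrix_mult.scaleR_right)
  ultimately show ?thesis
    by (simp add: tendsto_unique[OF trivial_limit_at])
qed

section \<open>The inverse property of Moufang loops\<close>

context moufang_loop
begin

text \<open>
  Take \<open>b\<close> with \<open>a b = e\<close>.  The instance \<open>(ab)(ha) = (a(bh))a\<close> of the Moufang identity gives \<open>a(bh) = h\<close>,
  and in particular \<open>b a = e\<close>.  Then the instance \<open>(ah)(ba) = (a(hb))a\<close>, together with \<open>a(ka) = (ak)a\<close>,
  gives \<open>(hb)a = h\<close>; cancellation supplies the other two identities.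
\<close>

lemma inverse_property_exists:
  "\<exists>b. (\<forall>h. a \<odot> (b \<odot> h) = h) \<and> (\<forall>h. b \<odot> (a \<odot> h) = h) \<and> (\<forall>h. (h \<odot> a) \<odot> b = h) \<and> (\<forall>h. (h \<odot> b) \<odot> a = h)"
proof -
  have cancel_left: "x = y" if "c \<odot> x = c \<odot> y" for c x y using that by (metis left_division)
  have cancel_right: "x = y" if "x \<odot> c = y \<odot> c" for c x y using that by (metis right_division)
  obtain b where ab: "a \<odot> b = e" using ex1_implies_ex[OF left_division[of a e]] ..
  have 1: "a \<odot> (b \<odot> h) = h" for h
    by (rule cancel_right[of _ a]) (simp add: moufang[symmetric] ab left_unit)
  have ba: "b \<odot> a = e"
    by (rule cancel_left[of a]) (simp add: 1 right_unit)
  have 2: "b \<odot> (a \<odot> h) = h" for h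
    using 1[of "a \<odot> h"] by (rule cancel_left)
  have flexible: "a \<odot> (h \<odot> a) = (a \<odot> h) \<odot> a" for h
    using moufang[of a e h] by (simp add: left_unit right_unit)
  have 3: "(h \<odot> b) \<odot> a = h" for h
    by (rule cancel_left[of a]) (simp add: flexible ba right_unit flip: moufang)
  have "(h \<odot> a) \<odot> b = h" for h
    using 3[of "h \<odot> a"] by (rule cancel_right)
  with 1 2 3 show ?thesis by blast
qed

lemma loop_inv_properties:
  shows loop_inv_cancel_left: "loop_inv mul e a \<odot> (a \<odot> h) = h"
    and cancel_right_loop_inv: "(h \<odot> a) \<odot> loop_inv mul e a = h"
    and loop_inv_left: "loop_inv mul e a \<odot> a = e"
    and loop_inv_right: "a \<odot> loop_inv mul e a = e"
proof -
  obtain b where b: "a \<odot> (b \<odot> h) = h" "b \<odot> (a \<odot> h) = h" "(h \<odot> a) \<odot> b = h" "(h \<odot> b) \<odot> a = h" for h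
    using inverse_property_exists[of a] by blast
  have "loop_inv mul e a = b"
    unfolding loop_inv_def
  proof (rule the_equality)
    show "a \<odot> b = e \<and> b \<odot> a = e" using b(1)[of e] b(2)[of e] by (simp add: right_unit)
    show "c = b" if "a \<odot> c = e \<and> c \<odot> a = e" for c
      using b(2)[of c] that by (simp add: right_unit)
  qed
  with b show "loop_inv mul e a \<odot> (a \<odot> h) = h" "(h \<odot> a) \<odot> loop_inv mul e a = h"
    "loop_inv mul e a \<odot> a = e" "a \<odot> loop_inv mul e a = e"
    using b(1)[of e] b(2)[of e] by (simp_all add: right_unit)
qed

text \<open>
  With \<open>x = gh\<close>, the right inverse property gives \<open>h x\<^sup>-\<^sup>1 = (g\<^sup>-\<^sup>1 x) x\<^sup>-\<^sup>1 = g\<^sup>-\<^sup>1\<close>.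
\<close>

lemma loop_inv_mult: "loop_inv mul e (g \<odot> h) = loop_inv mul e h \<odot> loop_inv mul e g"
proof -
  have "h \<odot> loop_inv mul e (g \<odot> h) = loop_inv mul e g"
    using cancel_right_loop_inv[of "loop_inv mul e g" "g \<odot> h"] by (simp add: loop_inv_cancel_left)
  then show ?thesis using loop_inv_cancel_left[of h "loop_inv mul e (g \<odot> h)"] by simp
qed

end

section \<open>Algebra of birepresentations\<close>

lemma matrix_inv_cancel:
  fixes A B :: "'k::field^'n::finite^'n"
  assumes "invertible A"
  shows "A ** (matrix_inv A ** B) = B" "matrix_inv A ** (A ** B) = B"
    "B ** A ** matrix_inv A = B" "B ** matrix_inv A ** A = B"
  using matrix_inv_left_right[OF assms] by (simp_all add: matrix_mul_assoc) (simp_all flip: matrix_mul_assoc)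

lemma matrix_inv_eqI:
  fixes A B :: "'k::field^'n::finite^'n"
  assumes "A ** B = mat 1"
  shows "matrix_inv A = B"
proof -
  have "invertible A" using assms invertible_right_inverse by blast
  then show ?thesis using assms matrix_inv_cancel(2)[of A B] by simp
qed

context birepresentation
begin

lemma S_T_commute: "T g ** S g = S g ** T g"
  using birep_S[of g e] by (simp add: S_unit right_unit)

lemma S_mult: "S (mul g h) = T g ** S g ** S h ** matrix_inv (T g)"
  using matrix_inv_cancel(3)[OF invertible_T[of g], of "S (mul g h)"] by (simp add: birep_S)

lemma S_loop_inv: "S (loop_inv mul e g) = matrix_inv (S g)"
proof -
  have "T g ** (S g ** S (loop_inv mul e g)) = T g"
    using birep_S[of g "loop_inv mul e g"] by (simp add: loop_inv_right S_unit matrix_mul_assoc)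
  then have "S g ** S (loop_inv mul e g) = mat 1"
    using matrix_inv_cancel(2)[OF invertible_T[of g], of "S g ** S (loop_inv mul e g)"]
    by (simp add: matrix_inv_left_right invertible_T)
  then show ?thesis by (metis matrix_inv_eqI)
qed

lemma T_loop_inv: "T (loop_inv mul e g) = matrix_inv (T g)"
proof -
  have "S g ** (T g ** T (loop_inv mul e g)) = S g"
    using birep_T[of g "loop_inv mul e g"] by (simp add: loop_inv_left T_unit matrix_mul_assoc)
  then have "T g ** T (loop_inv mul e g) = mat 1"
    using matrix_inv_cancel(2)[OF invertible_S[of g], of "T g ** T (loop_inv mul e g)"]
    by (simp add: matrix_inv_left_right invertible_S)
  then show ?thesis by (metis matrix_inv_eqI)
qed

text \<open>
  The two axioms at the inverses of \<open>g\<close> and \<open>h\<close>, interchanged by \<open>(gh)\<^sup>-\<^sup>1 = h\<^sup>-\<^sup>1 g\<^sup>-\<^sup>1\<close>.  This duality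
  exchanges the roles of \<open>S\<close> and \<open>T\<close> without changing the multiplication, so that every result about
  \<open>S\<close> has a counterpart for \<open>T\<close>.
\<close>

lemma dual_birepresentation: "birepresentation mul e (\<lambda>g. matrix_inv (T g)) (\<lambda>g. matrix_inv (S g))"
proof
  fix g h
  show "invertible (matrix_inv (T g))" "invertible (matrix_inv (S g))"
    unfolding S_loop_inv[symmetric] T_loop_inv[symmetric] by (rule invertible_T invertible_S)+
  show "matrix_inv (T e) = mat 1" "matrix_inv (S e) = mat 1"
    by (simp_all add: S_unit T_unit matrix_inv_eqI)
  show "matrix_inv (S g) ** matrix_inv (T g) ** matrix_inv (T h) = matrix_inv (T (mul g h)) ** matrix_inv (S g)"
    unfolding S_loop_inv[symmetric] T_loop_inv[symmetric] loop_inv_mult by (rule birep_T)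
  show "matrix_inv (T g) ** matrix_inv (S g) ** matrix_inv (S h) = matrix_inv (S (mul h g)) ** matrix_inv (T g)"
    unfolding S_loop_inv[symmetric] T_loop_inv[symmetric] loop_inv_mult by (rule birep_S)
qed

lemma T_mult: "T (mul g h) = matrix_inv (S g) ** T h ** S g ** T g"
proof -
  note inv = matrix_inv_cancel[OF invertible_S] matrix_inv_cancel[OF invertible_T] matrix_inv_left_right[OF invertible_S] matrix_inv_left_right[OF invertible_T]
  have "matrix_inv (T (mul g h)) = matrix_inv (S g) ** matrix_inv (T g) ** matrix_inv (T h) ** S g"
    using birepresentation.birep_S[OF dual_birepresentation, of g h]
    by (simp add: inv)
  then have "matrix_inv (T (mul g h)) ** (matrix_inv (S g) ** T h ** T g ** S g) = mat 1"
    by (simp add: inv flip: matrix_mul_assoc)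
  then have "T (mul g h) ** (matrix_inv (T (mul g h)) ** (matrix_inv (S g) ** T h ** T g ** S g)) = T (mul g h)"
    by simp
  then show ?thesis
    by (simp add: inv(5) S_T_commute flip: matrix_mul_assoc)
qed

text \<open>
  The comparison of two expressions for \<open>T\<^sub>g\<^sub>h\<close>: the one in the axiom, \<open>S\<^sub>h T\<^sub>h T\<^sub>g S\<^sub>h\<^sup>-\<^sup>1\<close>, and \<open>T_mult\<close>.
\<close>

lemma T_S_exchange: "S g ** S h ** T h ** T g = T h ** S g ** T g ** S h"
proof -
  have "S h ** T h ** T g = matrix_inv (S g) ** T h ** S g ** T g ** S h"
    using birep_T[of h g] by (simp add: T_mult)
  then have "S g ** (S h ** T h ** T g) = S g ** (matrix_inv (S g) ** T h ** S g ** T g ** S h)"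
    by simp
  then show ?thesis
    by (simp add: matrix_mul_assoc matrix_inv_left_right invertible_S)
qed

text \<open>
  For the translations \<open>S = L\<close> and \<open>T = R\<close> of the loop itself, the two factors are the left and right
  translation by \<open>h\<close> in the isotope \<open>x \<circ> y = (x g\<^sup>-\<^sup>1)(g y)\<close>, which is again a Moufang loop; they commute
  because Moufang loops are flexible.  In general both products turn out to be \<open>S\<^sub>h T\<^sub>h\<close>, by
  \<open>T_S_exchange\<close> at \<open>(h, g\<^sup>-\<^sup>1)\<close> and at \<open>(g, h)\<close>.
\<close>

lemma isotope_translations_commute:
  "(T g ** S h ** matrix_inv (T g)) ** (matrix_inv (S g) ** T h ** S g)
   = (matrix_inv (S g) ** T h ** S g) ** (T g ** S h ** matrix_inv (T g))"
proof -
  note inv = matrix_inv_left_right[OF invertible_S] matrix_inv_left_right[OF invertible_T]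
  note inv3 = matrix_inv_cancel(3,4)[OF invertible_S] matrix_inv_cancel(3,4)[OF invertible_T]
  have dual_commute: "matrix_inv (S g) ** matrix_inv (T g) = matrix_inv (T g) ** matrix_inv (S g)"
    by (rule birepresentation.S_T_commute[OF dual_birepresentation])
  have exchange: "S h ** matrix_inv (T g) ** matrix_inv (S g) ** T h = matrix_inv (T g) ** S h ** T h ** matrix_inv (S g)"
    using T_S_exchange[of h "loop_inv mul e g"]
    by (simp add: S_loop_inv T_loop_inv dual_commute flip: matrix_mul_assoc)
  have "(T g ** S h ** matrix_inv (T g)) ** (matrix_inv (S g) ** T h ** S g)
      = T g ** (S h ** matrix_inv (T g) ** matrix_inv (S g) ** T h) ** S g"
    by (simp add: matrix_mul_assoc)
  also have "\<dots> = S h ** T h"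
    unfolding exchange by (simp add: matrix_mul_assoc inv inv3)
  also have "\<dots> = matrix_inv (S g) ** (S g ** S h ** T h ** T g) ** matrix_inv (T g)"
    by (simp add: matrix_mul_assoc inv inv3)
  also have "\<dots> = (matrix_inv (S g) ** T h ** S g) ** (T g ** S h ** matrix_inv (T g))"
    unfolding T_S_exchange by (simp add: matrix_mul_assoc)
  finally show ?thesis .
qed

end

section \<open>Charts and the multiplication in coordinates\<close>

lemma real_analytic_on_cong:
  assumes f: "real_analytic_on f W" and W: "open W" and eq: "\<And>x. x \<in> W \<Longrightarrow> f x = g x"
  shows "real_analytic_on g W"
  unfolding real_analytic_on_def
proof
  fix x assume x: "x \<in> W"
  obtain \<epsilon> a where \<epsilon>: "0 < \<epsilon>" and a: "\<forall>y\<in>ball x \<epsilon>.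
      ((\<lambda>\<alpha>. (\<Prod>b\<in>Basis. ((y - x) \<bullet> b) ^ \<alpha> b) *\<^sub>R a \<alpha>) has_sum f y) (Basis \<rightarrow>\<^sub>E UNIV)"
    using bspec[OF f[unfolded real_analytic_on_def] x] by blast
  obtain \<rho> where \<rho>: "0 < \<rho>" "ball x \<rho> \<subseteq> W" using W x openE by blast
  have "\<forall>y\<in>ball x (min \<epsilon> \<rho>).
      ((\<lambda>\<alpha>. (\<Prod>b\<in>Basis. ((y - x) \<bullet> b) ^ \<alpha> b) *\<^sub>R a \<alpha>) has_sum g y) (Basis \<rightarrow>\<^sub>E UNIV)"
  proof
    fix y assume "y \<in> ball x (min \<epsilon> \<rho>)"
    then have "y \<in> ball x \<epsilon>" "f y = g y" using \<rho>(2) eq by auto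
    with a show "((\<lambda>\<alpha>. (\<Prod>b\<in>Basis. ((y - x) \<bullet> b) ^ \<alpha> b) *\<^sub>R a \<alpha>) has_sum g y) (Basis \<rightarrow>\<^sub>E UNIV)"
      by fastforce
  qed
  with \<epsilon> \<rho>(1) show "\<exists>\<epsilon>>0. \<exists>a. \<forall>y\<in>ball x \<epsilon>.
      ((\<lambda>\<alpha>. (\<Prod>b\<in>Basis. ((y - x) \<bullet> b) ^ \<alpha> b) *\<^sub>R a \<alpha>) has_sum g y) (Basis \<rightarrow>\<^sub>E UNIV)"
    by (intro exI[of _ "min \<epsilon> \<rho>"] conjI exI[of _ a]) auto
qed

lemma is_chartD:
  assumes "is_chart X"
  shows is_chart_open_dom: "open (chart_dom X)"
    and is_chart_open_image: "open (chart_map X ` chart_dom X)"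
    and chart_inv_chart_map: "g \<in> chart_dom X \<Longrightarrow> chart_inv X (chart_map X g) = g"
    and chart_map_chart_inv: "x \<in> chart_map X ` chart_dom X \<Longrightarrow> chart_map X (chart_inv X x) = x"
    and chart_inv_in_dom: "x \<in> chart_map X ` chart_dom X \<Longrightarrow> chart_inv X x \<in> chart_dom X"
    and continuous_on_chart_inv: "continuous_on (chart_map X ` chart_dom X) (chart_inv X)"
  using assms unfolding is_chart_def homeomorphism_def by auto

lemma bounded_linear_axis_expansion:
  fixes f :: "real^'r::finite \<Rightarrow> 'b::real_normed_vector"
  assumes "bounded_linear f"
  shows "f h = (\<Sum>j\<in>UNIV. h $ j *\<^sub>R f (axis j 1))"
proof -
  interpret bounded_linear f by fact
  have "f h = f (\<Sum>j\<in>UNIV. h $ j *\<^sub>R axis j 1)"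
    using basis_expansion[of h] by (simp add: scalar_mult_eq_scaleR)
  then show ?thesis by (simp add: sum scaleR)
qed

lemma coord_deriv_eq:
  assumes "((F \<circ> chart_inv X) has_derivative D) (at (chart_map X g))"
  shows "coord_deriv X j F g = D (axis j 1)"
proof -
  have "((\<lambda>t::real. chart_map X g + t *\<^sub>R axis j 1) has_derivative (\<lambda>t. t *\<^sub>R axis j 1)) (at 0)"
    by (auto intro!: derivative_eq_intros)
  then have "((\<lambda>t. (F \<circ> chart_inv X) (chart_map X g + t *\<^sub>R axis j 1)) has_derivative (\<lambda>t. D (t *\<^sub>R axis j 1))) (at 0)"
    by (rule has_derivative_compose) (use assms in \<open>simp add: o_def\<close>)
  moreover have "D (t *\<^sub>R axis j 1) = t *\<^sub>R D (axis j 1)" for t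
    using assms by (simp add: has_derivative_bounded_linear linear_cmul bounded_linear.linear)
  ultimately have "((\<lambda>t. F (chart_inv X (chart_map X g + t *\<^sub>R axis j 1))) has_vector_derivative D (axis j 1)) (at 0)"
    by (simp add: has_vector_derivative_def)
  then show ?thesis unfolding coord_deriv_def by (rule vector_derivative_at)
qed

context analytic_moufang_loop
begin

lemma is_chart: "X \<in> \<A> \<Longrightarrow> is_chart X"
  using analytic_atlas unfolding analytic_atlas_def by blast

text \<open>
  The set of pairs of coordinates on which the multiplication, read in the charts \<open>X\<close>, \<open>Y\<close> and \<open>Z\<close>, is
  defined.  Different charts are admitted since \<open>g\<^sup>-\<^sup>1\<close> may lie outside the chart around \<open>e\<close>.
\<close>

definition chart_product_dom ::
    "('g, real^'r) chart \<Rightarrow> ('g, real^'r) chart \<Rightarrow> ('g, real^'r) chart \<Rightarrow> ((real^'r) \<times> (real^'r)) set"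
  where "chart_product_dom X Y Z = {(x, y). x \<in> chart_map X ` chart_dom X \<and> y \<in> chart_map Y ` chart_dom Y \<and>
    mul (chart_inv X x) (chart_inv Y y) \<in> chart_dom Z}"

lemma chart_product:
  assumes X: "X \<in> \<A>" and Y: "Y \<in> \<A>" and Z: "Z \<in> \<A>"
  shows open_chart_product_dom: "open (chart_product_dom X Y Z)"
    and real_analytic_on_chart_product:
      "real_analytic_on (\<lambda>(x, y). chart_map Z (mul (chart_inv X x) (chart_inv Y y))) (chart_product_dom X Y Z)"
proof -
  let ?U = "chart_map X ` chart_dom X" and ?V = "chart_map Y ` chart_dom Y"
  let ?F = "\<lambda>(g, h). mul g h"
  let ?P = "(chart_dom X \<times> chart_dom Y, map_prod (chart_map X) (chart_map Y))"
  note X' = is_chartD[OF is_chart[OF X]] and Y' = is_chartD[OF is_chart[OF Y]] and Z' = is_chartD[OF is_chart[OF Z]]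
  have contF: "continuous_on UNIV ?F"
    using analytic_mult unfolding analytic_map_def by blast
  have "continuous_on (?U \<times> ?V) (\<lambda>p. (chart_inv X (fst p), chart_inv Y (snd p)))"
    by (intro continuous_on_Pair continuous_on_compose2[OF X'(6)] continuous_on_compose2[OF Y'(6)])
      (auto intro!: continuous_intros)
  then have "continuous_on (?U \<times> ?V) (\<lambda>p. ?F (chart_inv X (fst p), chart_inv Y (snd p)))"
    by (rule continuous_on_compose2[OF contF]) auto
  then have "open ((?U \<times> ?V) \<inter> (\<lambda>p. ?F (chart_inv X (fst p), chart_inv Y (snd p))) -` chart_dom Z)"
    by (rule continuous_open_preimage) (intro open_Times X'(2) Y'(2) Z'(1))+
  also have "(?U \<times> ?V) \<inter> (\<lambda>p. ?F (chart_inv X (fst p), chart_inv Y (snd p))) -` chart_dom Z = chart_product_dom X Y Z"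
    by (auto simp: chart_product_dom_def)
  finally show W: "open (chart_product_dom X Y Z)" .
  have inv: "chart_inv ?P (x, y) = (chart_inv X x, chart_inv Y y)" if "x \<in> ?U" "y \<in> ?V" for x y
  proof -
    have "inj_on (map_prod (chart_map X) (chart_map Y)) (chart_dom X \<times> chart_dom Y)"
      by (intro map_prod_inj_on inj_on_inverseI[of _ "chart_inv X"] inj_on_inverseI[of _ "chart_inv Y"] X'(3) Y'(3))
    then show ?thesis
      unfolding chart_inv_def[of ?P]
      by (intro inv_into_f_eq) (use X'(4,5) Y'(4,5) that in auto)
  qed
  have "?P \<in> prod_atlas \<A> \<A>" unfolding prod_atlas_def using X Y by blast
  then have "real_analytic_on (chart_map Z \<circ> ?F \<circ> chart_inv ?P) (chart_map ?P ` (chart_dom ?P \<inter> ?F -` chart_dom Z))"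
    using analytic_mult Z unfolding analytic_map_def by blast
  also have "chart_map ?P ` (chart_dom ?P \<inter> ?F -` chart_dom Z) = chart_product_dom X Y Z"
  proof (intro equalityI subsetI)
    fix p assume "p \<in> chart_map ?P ` (chart_dom ?P \<inter> ?F -` chart_dom Z)"
    then show "p \<in> chart_product_dom X Y Z"
      by (auto simp: chart_product_dom_def X'(3) Y'(3))
  next
    fix p assume "p \<in> chart_product_dom X Y Z"
    then show "p \<in> chart_map ?P ` (chart_dom ?P \<inter> ?F -` chart_dom Z)"
      using X'(4,5) Y'(4,5)
      by (intro image_eqI[of _ _ "(chart_inv X (fst p), chart_inv Y (snd p))"])
        (auto simp: chart_product_dom_def)
  qed
  finally show "real_analytic_on (\<lambda>(x, y). chart_map Z (mul (chart_inv X x) (chart_inv Y y))) (chart_product_dom X Y Z)"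
    by (rule real_analytic_on_cong[OF _ W]) (use inv in \<open>auto simp: chart_product_dom_def\<close>)
qed

end

section \<open>The frame of left translations\<close>

locale moufang_loop_unit_chart = analytic_moufang_loop mul e \<A>
  for mul :: "'g::t2_space \<Rightarrow> 'g \<Rightarrow> 'g" and e :: 'g and \<A> :: "('g, real^'r::finite) chart set" +
  fixes X :: "('g, real^'r) chart"
  assumes X_in_atlas: "X \<in> \<A>" and unit_in_dom: "e \<in> chart_dom X"
begin

abbreviation "coords \<equiv> chart_map X"
abbreviation "point \<equiv> chart_inv X"
abbreviation "coord_image \<equiv> chart_map X ` chart_dom X"

lemmas open_coord_image = is_chart_open_image[OF is_chart[OF X_in_atlas]]
  and point_coords = chart_inv_chart_map[OF is_chart[OF X_in_atlas]]
  and coords_point = chart_map_chart_inv[OF is_chart[OF X_in_atlas]]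
  and point_in_dom = chart_inv_in_dom[OF is_chart[OF X_in_atlas]]

definition frame :: "'r \<Rightarrow> 'g \<Rightarrow> real^'r"
  where "frame j g = (\<chi> i. aux_fun mul e X j i g)"

text \<open>
  Both statements concern the derivative of the analytic map \<open>(x, y) \<mapsto> x y\<close> at \<open>(g, e)\<close> in the second
  argument: its value is given by the auxiliary functions, and it depends differentiably on \<open>g\<close> because
  the partial derivatives of an analytic map are analytic.
\<close>

lemma frame_calculus:
  assumes g: "g \<in> chart_dom X"
  shows left_translation_has_derivative:
      "((\<lambda>y. coords (mul g (point y))) has_derivative (\<lambda>h. \<Sum>j\<in>UNIV. h $ j *\<^sub>R frame j g)) (at (coords e))"
    and frame_differentiable: "(frame j \<circ> point) differentiable (at (coords g))"
proof -
  let ?W = "chart_product_dom X X X"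
  let ?L = "\<lambda>(x, y). coords (mul (point x) (point y))"
  obtain D where D': "\<forall>b\<in>Basis. real_analytic_on (D b) ?W"
    and L': "\<forall>z\<in>?W. (?L has_derivative (\<lambda>h. \<Sum>b\<in>Basis. (h \<bullet> b) *\<^sub>R D b z)) (at z)"
    using real_analytic_on_has_analytic_partials
      [OF real_analytic_on_chart_product[OF X_in_atlas X_in_atlas X_in_atlas]] by blast
  note D = bspec[OF D'] and L = bspec[OF L']
  have inW: "(coords k, coords e) \<in> ?W" if "k \<in> chart_dom X" for k
    using that unit_in_dom by (simp add: chart_product_dom_def point_coords right_unit)
  have axis_Basis: "(0, axis j 1) \<in> (Basis :: ((real^'r) \<times> (real^'r)) set)" for j
    by (auto simp: Basis_prod_def Basis_vec_def)
  define L' where "L' k h = (\<Sum>b\<in>Basis. ((0, h) \<bullet> b) *\<^sub>R D b (coords k, coords e))" for k h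
  have L': "((\<lambda>y. coords (mul k (point y))) has_derivative L' k) (at (coords e))" if "k \<in> chart_dom X" for k
  proof -
    have "((\<lambda>y. (coords k, y)) has_derivative (\<lambda>h. (0, h))) (at (coords e))"
      by (auto intro!: derivative_eq_intros)
    from has_derivative_compose[OF this L[OF inW[OF that]]] show ?thesis
      by (simp add: L'_def[abs_def] point_coords[OF that])
  qed
  have frame_L': "frame j k = L' k (axis j 1)" if "k \<in> chart_dom X" for j k
  proof -
    have "aux_fun mul e X j i k = L' k (axis j 1) $ i" for i
      unfolding aux_fun_def
      by (rule coord_deriv_eq) (use bounded_linear.has_derivative[OF bounded_linear_vec_nth L'[OF that]] in \<open>simp add: o_def\<close>)
    then show ?thesis by (simp add: frame_def vec_eq_iff)
  qed
  show "((\<lambda>y. coords (mul g (point y))) has_derivative (\<lambda>h. \<Sum>j\<in>UNIV. h $ j *\<^sub>R frame j g)) (at (coords e))"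
    by (rule has_derivative_eq_rhs[OF L'[OF g]], rule ext)
      (simp add: frame_L'[OF g] bounded_linear_axis_expansion[OF has_derivative_bounded_linear[OF L'[OF g]], symmetric])
  have "frame j (point x) = D (0, axis j 1) (x, coords e)" if "x \<in> coord_image" for x
  proof -
    have "frame j (point x) = (\<Sum>b\<in>Basis. ((0, axis j 1) \<bullet> b) *\<^sub>R D b (x, coords e))"
      using frame_L'[OF point_in_dom[OF that]] that by (simp add: L'_def coords_point)
    also have "\<dots> = (\<Sum>b\<in>Basis. if b = (0, axis j 1) then D b (x, coords e) else 0)"
      by (intro sum.cong refl) (use axis_Basis[of j] in \<open>auto simp only: inner_Basis scaleR_one scaleR_zero_left split: if_splits\<close>)
    finally show ?thesis using axis_Basis[of j] by simp
  qed
  moreover have "(\<lambda>x. D (0, axis j 1) (x, coords e)) differentiable (at (coords g))"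
    by (intro differentiable_compose[of "D (0, axis j 1)" "\<lambda>x. (x, coords e)"]
        real_analytic_on_imp_differentiable[OF D[OF axis_Basis] inW[OF g]]) (auto intro!: derivative_eq_intros simp: differentiable_def)
  ultimately show "(frame j \<circ> point) differentiable (at (coords g))"
    unfolding differentiable_def
    using has_derivative_transform_within_open[OF _ open_coord_image imageI[OF g], of "\<lambda>x. D (0, axis j 1) (x, coords e)" _ _ "frame j \<circ> point"]
    by (metis comp_apply)
qed

lemma left_translation_stays_in_dom:
  assumes "g \<in> chart_dom X"
  shows "\<exists>V. open V \<and> coords e \<in> V \<and> V \<subseteq> coord_image \<and> (\<forall>y\<in>V. mul g (point y) \<in> chart_dom X)"
proof (intro exI[of _ "(\<lambda>y. (coords g, y)) -` chart_product_dom X X X"] conjI)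
  show "open ((\<lambda>y. (coords g, y)) -` chart_product_dom X X X)"
    by (intro open_vimage open_chart_product_dom X_in_atlas continuous_intros)
qed (use assms unit_in_dom in \<open>auto simp: chart_product_dom_def point_coords right_unit\<close>)

lemma left_translation_at_unit: "g \<in> chart_dom X \<Longrightarrow> coords (mul g (point (coords e))) = coords g"
  by (simp add: point_coords unit_in_dom right_unit)

definition frame_matrix :: "'g \<Rightarrow> real^'r^'r"
  where "frame_matrix g = (\<chi> i j. aux_fun mul e X j i g)"

lemma frame_matrix_mult_vector: "frame_matrix g *v h = (\<Sum>j\<in>UNIV. h $ j *\<^sub>R frame j g)"
  by (simp add: frame_matrix_def frame_def matrix_vector_mult_def vec_eq_iff mult.commute)

lemma frame_matrix_differentiable:
  assumes "g \<in> chart_dom X"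
  shows "(frame_matrix \<circ> point) differentiable (at (coords g))"
proof (subst differentiable_componentwise_within, intro ballI)
  fix b :: "real^'r^'r" assume "b \<in> Basis"
  then obtain i j where b: "b = axis i (axis j 1)" by (auto simp: Basis_vec_def)
  have "(\<lambda>x. (frame j \<circ> point) x $ i) differentiable (at (coords g))"
    using frame_differentiable[OF assms, of j] bounded_linear.has_derivative[OF bounded_linear_vec_nth]
    unfolding differentiable_def by blast
  then show "(\<lambda>x. (frame_matrix \<circ> point) x \<bullet> b) differentiable (at (coords g))"
    by (simp add: b inner_axis frame_matrix_def frame_def o_def)
qed

text \<open>
  Left translation by \<open>g\<^sup>-\<^sup>1\<close> is differentiable at \<open>g\<close> and undoes left translation by \<open>g\<close>, so the
  derivative of the latter at \<open>e\<close>, which is this matrix, is injective.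
\<close>

lemma frame_matrix_invertible:
  assumes g: "g \<in> chart_dom X"
  shows "invertible (frame_matrix g)"
proof -
  let ?g' = "loop_inv mul e g"
  obtain Y where Y: "Y \<in> \<A>" "?g' \<in> chart_dom Y"
    using analytic_atlas unfolding analytic_atlas_def by blast
  have Y': "chart_inv Y (chart_map Y ?g') = ?g'"
    by (rule chart_inv_chart_map[OF is_chart[OF Y(1)] Y(2)])
  let ?L = "\<lambda>(x, y). coords (mul (chart_inv Y x) (point y))"
  have "(chart_map Y ?g', coords g) \<in> chart_product_dom Y X X"
    using g Y(2) unit_in_dom by (simp add: chart_product_dom_def Y' point_coords loop_inv_left)
  then have "?L differentiable (at (chart_map Y ?g', coords g))"
    by (rule real_analytic_on_imp_differentiable[OF real_analytic_on_chart_product[OF Y(1) X_in_atlas X_in_atlas]])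
  then obtain L' where L': "(?L has_derivative L') (at (chart_map Y ?g', coords g))"
    unfolding differentiable_def by blast
  have "((\<lambda>y. (chart_map Y ?g', y)) has_derivative (\<lambda>h. (0, h))) (at (coords g))"
    by (auto intro!: derivative_eq_intros)
  from has_derivative_compose[OF this L']
  have inverse_translation: "((\<lambda>y. coords (mul ?g' (point y))) has_derivative (\<lambda>h. L' (0, h))) (at (coords g))"
    by (simp add: Y')
  let ?N' = "\<lambda>h. \<Sum>j\<in>UNIV. h $ j *\<^sub>R frame j g"
  have comp: "((\<lambda>y. coords (mul ?g' (point (coords (mul g (point y)))))) has_derivative (\<lambda>h. L' (0, ?N' h))) (at (coords e))"
    by (rule has_derivative_compose[OF left_translation_has_derivative[OF g]])
      (simp only: left_translation_at_unit[OF g] inverse_translation)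
  obtain V where V: "open V" "coords e \<in> V" "V \<subseteq> coord_image" "\<forall>y\<in>V. mul g (point y) \<in> chart_dom X"
    using left_translation_stays_in_dom[OF g] by blast
  have "((\<lambda>y. y) has_derivative (\<lambda>h. L' (0, ?N' h))) (at (coords e))"
    by (rule has_derivative_transform_within_open[OF comp V(1,2)])
      (use V(3,4) in \<open>auto simp: point_coords loop_inv_cancel_left coords_point subset_iff\<close>)
  then have "(\<lambda>h. L' (0, ?N' h)) = (\<lambda>h. h)"
    by (rule has_derivative_unique) (rule has_derivative_ident)
  then have "L' (0, ?N' h) = h" for h by (rule fun_cong)
  then have "inj ?N'" by (rule inj_on_inverseI[where g = "\<lambda>z. L' (0, z)"])
  then have "inj ((*v) (frame_matrix g))" unfolding frame_matrix_mult_vector[abs_def] .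
  then show ?thesis
    unfolding invertible_left_inverse matrix_left_invertible_injective .
qed

text \<open>
  Invertibility of the frame matrix makes the Maurer-Cartan equations uniquely solvable, which is what the
  definite description in \<open>structure_fun\<close> requires.
\<close>

lemma structure_equation:
  assumes "g \<in> chart_dom X"
  shows "(\<Sum>m\<in>UNIV. aux_fun mul e X j m g * coord_deriv X m (aux_fun mul e X k i) g
            - aux_fun mul e X k m g * coord_deriv X m (aux_fun mul e X j i) g)
    = (\<Sum>m\<in>UNIV. structure_fun mul e X j k m g * aux_fun mul e X m i g)"
proof -
  define b where "b = (\<chi> i. \<Sum>m\<in>UNIV. aux_fun mul e X j m g * coord_deriv X m (aux_fun mul e X k i) g
            - aux_fun mul e X k m g * coord_deriv X m (aux_fun mul e X j i) g)"
  let ?P = "\<lambda>c :: 'r \<Rightarrow> real. \<forall>i.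
      (\<Sum>m\<in>UNIV. aux_fun mul e X j m g * coord_deriv X m (aux_fun mul e X k i) g
            - aux_fun mul e X k m g * coord_deriv X m (aux_fun mul e X j i) g)
      = (\<Sum>m\<in>UNIV. c m * aux_fun mul e X m i g)"
  have P: "?P c \<longleftrightarrow> frame_matrix g *v (\<chi> m. c m) = b" for c
    by (auto simp: b_def vec_eq_iff frame_matrix_def matrix_vector_mult_def mult.commute)
  note inv = matrix_inv_left_right[OF frame_matrix_invertible[OF assms]]
  have "\<exists>!c. ?P c"
  proof
    show "?P (\<lambda>m. (matrix_inv (frame_matrix g) *v b) $ m)"
      unfolding P by (simp add: matrix_vector_mul_assoc inv)
    show "c = (\<lambda>m. (matrix_inv (frame_matrix g) *v b) $ m)" if "?P c" for c
    proof -
      have "matrix_inv (frame_matrix g) *v b = (\<chi> m. c m)"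
        unfolding that[unfolded P, symmetric] by (simp add: matrix_vector_mul_assoc inv)
      then show ?thesis by simp
    qed
  qed
  from theI'[OF this] show ?thesis unfolding structure_fun_def by blast
qed

text \<open>
  The derivative of \<open>F\<close> along the vector field \<open>V\<^sub>j\<close>.
\<close>

definition frame_deriv :: "'r \<Rightarrow> ('g \<Rightarrow> 'b::real_normed_vector) \<Rightarrow> 'g \<Rightarrow> 'b"
  where "frame_deriv j F g = (\<Sum>n\<in>UNIV. aux_fun mul e X j n g *\<^sub>R coord_deriv X n F g)"

lemma frame_deriv_eq:
  assumes "((F \<circ> point) has_derivative D) (at (coords g))"
  shows "frame_deriv j F g = D (frame j g)"
  unfolding frame_deriv_def coord_deriv_eq[OF assms]
  by (subst (2) bounded_linear_axis_expansion[OF has_derivative_bounded_linear[OF assms]]) (simp add: frame_def)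

lemma differentiable_at_point_cong:
  assumes "((F \<circ> point) has_derivative D) (at (coords g))" "g \<in> chart_dom X"
    and "\<And>k. k \<in> chart_dom X \<Longrightarrow> F k = G k"
  shows "((G \<circ> point) has_derivative D) (at (coords g))"
  by (rule has_derivative_transform_within_open[OF assms(1) open_coord_image imageI[OF assms(2)]])
    (simp add: assms(3) point_in_dom)

lemma differentiable_in_chart_iff:
  "differentiable_map {X} F \<longleftrightarrow> (\<forall>g\<in>chart_dom X. \<exists>D. ((F \<circ> point) has_derivative D) (at (coords g)))"
  using open_coord_image
  by (auto simp: differentiable_map_def differentiable_on_eq_differentiable_at differentiable_def)

text \<open>
  The source of the generalized Lie equations: differentiate \<open>F(gh) = \<Phi>(F(h))\<close> with respect to \<open>h\<close> at \<open>e\<close>.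
\<close>

lemma frame_deriv_of_equivariant:
  fixes F :: "'g \<Rightarrow> 'b::real_normed_vector"
  assumes F: "differentiable_map {X} F" and g: "g \<in> chart_dom X"
    and \<Phi>: "bounded_linear \<Phi>" and equi: "\<And>h. F (mul g h) = \<Phi> (F h)"
  shows "frame_deriv j F g = \<Phi> (coord_deriv X j F e)"
proof -
  obtain D where D: "((F \<circ> point) has_derivative D) (at (coords g))"
    using F g unfolding differentiable_in_chart_iff by blast
  obtain D0 where D0: "((F \<circ> point) has_derivative D0) (at (coords e))"
    using F unit_in_dom unfolding differentiable_in_chart_iff by blast
  let ?N' = "\<lambda>h. \<Sum>j\<in>UNIV. h $ j *\<^sub>R frame j g"
  have left: "((\<lambda>y. (F \<circ> point) (coords (mul g (point y)))) has_derivative (\<lambda>h. D (?N' h))) (at (coords e))"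
    by (rule has_derivative_compose[OF left_translation_has_derivative[OF g]])
      (simp only: left_translation_at_unit[OF g] D)
  obtain V where V: "open V" "coords e \<in> V" "V \<subseteq> coord_image" "\<forall>y\<in>V. mul g (point y) \<in> chart_dom X"
    using left_translation_stays_in_dom[OF g] by blast
  have "((\<lambda>y. \<Phi> ((F \<circ> point) y)) has_derivative (\<lambda>h. D (?N' h))) (at (coords e))"
    by (rule has_derivative_transform_within_open[OF left V(1,2)])
      (simp add: V(4) point_coords equi)
  then have "(\<lambda>h. D (?N' h)) = (\<lambda>h. \<Phi> (D0 h))"
    by (rule has_derivative_unique) (rule bounded_linear.has_derivative[OF \<Phi> D0])
  then have "D (?N' (axis j 1)) = \<Phi> (D0 (axis j 1))" by (rule fun_cong)
  moreover have "?N' (axis j 1) = frame j g"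
    by (subst frame_matrix_mult_vector[symmetric]) (simp add: frame_matrix_def frame_def vec_eq_iff matrix_vector_mult_def axis_def if_distrib cong: if_cong)
  ultimately show ?thesis
    by (simp add: frame_deriv_eq[OF D] coord_deriv_eq[OF D0])
qed

lemma coord_deriv_eq_frame_derivs:
  assumes "g \<in> chart_dom X"
  shows "coord_deriv X n F g = (\<Sum>j\<in>UNIV. matrix_inv (frame_matrix g) $ j $ n *\<^sub>R frame_deriv j F g)"
proof -
  let ?A = "frame_matrix g" and ?B = "matrix_inv (frame_matrix g)"
  have "(\<Sum>j\<in>UNIV. ?B $ j $ n *\<^sub>R frame_deriv j F g)
      = (\<Sum>m\<in>UNIV. (\<Sum>j\<in>UNIV. ?A $ m $ j * ?B $ j $ n) *\<^sub>R coord_deriv X m F g)"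
    unfolding frame_deriv_def scaleR_sum_right scaleR_sum_left
    by (subst sum.swap) (simp add: frame_matrix_def mult.commute)
  also have "\<dots> = (\<Sum>m\<in>UNIV. (?A ** ?B) $ m $ n *\<^sub>R coord_deriv X m F g)"
    by (simp add: matrix_matrix_mult_def)
  also have "\<dots> = (\<Sum>m\<in>UNIV. if m = n then coord_deriv X m F g else 0)"
    unfolding matrix_inv_left_right(1)[OF frame_matrix_invertible[OF assms]]
    by (intro sum.cong refl) (simp add: mat_def)
  finally show ?thesis by simp
qed

text \<open>
  The gain of regularity: partial derivatives are combinations of derivatives along the frame, with the
  entries of the inverse frame matrix as differentiable coefficients.
\<close>

lemma differentiable_coord_deriv:
  assumes F: "\<And>j. differentiable_map {X} (frame_deriv j F)"
  shows "differentiable_map {X} (coord_deriv X n F)"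
  unfolding differentiable_in_chart_iff
proof
  fix g assume g: "g \<in> chart_dom X"
  obtain A' where A': "((frame_matrix \<circ> point) has_derivative A') (at (coords g))"
    using frame_matrix_differentiable[OF g] unfolding differentiable_def by blast
  have "eventually (\<lambda>x. x \<in> coord_image) (at (coords g))"
    using open_coord_image g by (intro eventually_at_in_open') auto
  then have "eventually (\<lambda>x. invertible ((frame_matrix \<circ> point) x)) (at (coords g))"
    by eventually_elim (simp add: frame_matrix_invertible point_in_dom)
  moreover have "invertible ((frame_matrix \<circ> point) (coords g))"
    using g by (simp add: frame_matrix_invertible point_coords)
  ultimately obtain B' where B': "((\<lambda>x. matrix_inv ((frame_matrix \<circ> point) x)) has_derivative B') (at (coords g))"
    using has_derivative_matrix_inv[OF A'] by blast
  have B'': "((\<lambda>x. matrix_inv ((frame_matrix \<circ> point) x) $ j $ n) has_derivative (\<lambda>h. B' h $ j $ n)) (at (coords g))" for j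
    by (intro bounded_linear.has_derivative[OF bounded_linear_vec_nth] B')
  have "\<forall>j. \<exists>D. ((frame_deriv j F \<circ> point) has_derivative D) (at (coords g))"
    using F g unfolding differentiable_in_chart_iff by blast
  from choice[OF this] obtain D where D: "\<And>j. ((frame_deriv j F \<circ> point) has_derivative D j) (at (coords g))" by blast
  have "(((\<lambda>k. \<Sum>j\<in>UNIV. matrix_inv (frame_matrix k) $ j $ n *\<^sub>R frame_deriv j F k) \<circ> point) has_derivative
      (\<lambda>h. \<Sum>j\<in>UNIV. matrix_inv ((frame_matrix \<circ> point) (coords g)) $ j $ n *\<^sub>R D j h
          + B' h $ j $ n *\<^sub>R (frame_deriv j F \<circ> point) (coords g))) (at (coords g))"
    unfolding o_def
    by (intro has_derivative_sum has_derivative_scaleR B''[unfolded o_def] D[unfolded o_def])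
  then show "\<exists>D. ((coord_deriv X n F \<circ> point) has_derivative D) (at (coords g))"
    by (intro exI) (rule differentiable_at_point_cong[OF _ g coord_deriv_eq_frame_derivs[symmetric]])
qed

lemma coord_derivs_commute:
  assumes F: "differentiable_map {X} F" and F': "\<And>n. differentiable_map {X} (coord_deriv X n F)"
    and g: "g \<in> chart_dom X"
  shows "coord_deriv X j (coord_deriv X k F) g = coord_deriv X k (coord_deriv X j F) g"
proof -
  have "\<forall>x\<in>coord_image. \<exists>D. ((F \<circ> point) has_derivative D) (at x)"
    using F unfolding differentiable_in_chart_iff by blast
  from bchoice[OF this] obtain D where
    D: "\<And>x. x \<in> coord_image \<Longrightarrow> ((F \<circ> point) has_derivative D x) (at x)" by blast
  have D_eq: "coord_deriv X n F k = D (coords k) (axis n 1)" if "k \<in> chart_dom X" for k n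
    by (rule coord_deriv_eq) (use D that in blast)
  have "\<forall>n. \<exists>E. ((coord_deriv X n F \<circ> point) has_derivative E) (at (coords g))"
    using F' g unfolding differentiable_in_chart_iff by blast
  from choice[OF this] obtain E where E: "\<And>n. ((coord_deriv X n F \<circ> point) has_derivative E n) (at (coords g))" by blast
  have D': "((\<lambda>x. D x (axis n 1)) has_derivative E n) (at (coords g))" for n
    by (rule has_derivative_transform_within_open[OF E open_coord_image imageI[OF g]])
      (simp add: D_eq point_in_dom coords_point)
  have "E k (axis j 1) = E j (axis k 1)"
    by (rule mixed_derivatives_symmetric[OF open_coord_image imageI[OF g] D D' D'])
  then show ?thesis by (simp add: coord_deriv_eq[OF E])
qed

text \<open>
  The bracket of two vector fields of the frame is a first-order operator, expanded in the frame by the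
  structure functions.
\<close>

lemma frame_deriv_bracket:
  fixes F :: "'g \<Rightarrow> 'b::real_normed_vector"
  assumes F: "differentiable_map {X} F" and F': "\<And>n. differentiable_map {X} (coord_deriv X n F)"
    and g: "g \<in> chart_dom X"
  shows "frame_deriv j (frame_deriv k F) g - frame_deriv k (frame_deriv j F) g
    = (\<Sum>n\<in>UNIV. structure_fun mul e X j k n g *\<^sub>R frame_deriv n F g)"
proof -
  let ?v = "\<lambda>j n. aux_fun mul e X j n g" and ?d = "coord_deriv X"
  \<comment> \<open>The first sum is symmetric in \<open>j\<close> and \<open>k\<close> since mixed derivatives agree; the second gives the bracket.\<close>
  have second: "frame_deriv j (frame_deriv k F) g
      = (\<Sum>n\<in>UNIV. \<Sum>m\<in>UNIV. (?v k n * ?v j m) *\<^sub>R ?d m (?d n F) g)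
        + (\<Sum>n\<in>UNIV. \<Sum>m\<in>UNIV. (?v j m * ?d m (aux_fun mul e X k n) g) *\<^sub>R ?d n F g)" for j k
  proof -
    obtain V' where V': "((frame k \<circ> point) has_derivative V') (at (coords g))"
      using frame_differentiable[OF g] unfolding differentiable_def by blast
    have v': "((aux_fun mul e X k n \<circ> point) has_derivative (\<lambda>h. V' h $ n)) (at (coords g))" for n
      using bounded_linear.has_derivative[OF bounded_linear_vec_nth V'] by (simp add: frame_def o_def)
    have "\<forall>n. \<exists>E. ((?d n F \<circ> point) has_derivative E) (at (coords g))"
      using F' g unfolding differentiable_in_chart_iff by blast
    from choice[OF this] obtain E where E: "\<And>n. ((?d n F \<circ> point) has_derivative E n) (at (coords g))" by blast
    have "((frame_deriv k F \<circ> point) has_derivative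
        (\<lambda>h. \<Sum>n\<in>UNIV. ?v k n *\<^sub>R E n h + V' h $ n *\<^sub>R ?d n F g)) (at (coords g))"
      using has_derivative_sum[where I = UNIV, OF has_derivative_scaleR[OF v' E]]
      by (simp add: frame_deriv_def[abs_def] o_def point_coords[OF g])
    then have "frame_deriv j (frame_deriv k F) g = (\<Sum>n\<in>UNIV. ?v k n *\<^sub>R E n (frame j g) + V' (frame j g) $ n *\<^sub>R ?d n F g)"
      by (rule frame_deriv_eq)
    also have "\<dots> = (\<Sum>n\<in>UNIV. ?v k n *\<^sub>R frame_deriv j (?d n F) g + frame_deriv j (aux_fun mul e X k n) g *\<^sub>R ?d n F g)"
      unfolding frame_deriv_eq[OF E] frame_deriv_eq[OF v'] ..
    finally show ?thesis
      by (simp add: frame_deriv_def sum.distrib scaleR_sum_right scaleR_sum_left)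
  qed
  have "(\<Sum>n\<in>UNIV. \<Sum>m\<in>UNIV. (?v k n * ?v j m) *\<^sub>R ?d m (?d n F) g)
      = (\<Sum>n\<in>UNIV. \<Sum>m\<in>UNIV. (?v j n * ?v k m) *\<^sub>R ?d m (?d n F) g)"
    by (subst sum.swap) (simp add: coord_derivs_commute[OF F F' g] mult.commute)
  then have "frame_deriv j (frame_deriv k F) g - frame_deriv k (frame_deriv j F) g
    = (\<Sum>n\<in>UNIV. (\<Sum>m\<in>UNIV. ?v j m * ?d m (aux_fun mul e X k n) g - ?v k m * ?d m (aux_fun mul e X j n) g) *\<^sub>R ?d n F g)"
    unfolding second by (simp add: sum_subtractf scaleR_left_diff_distrib scaleR_sum_left)
  also have "\<dots> = (\<Sum>n\<in>UNIV. (\<Sum>m\<in>UNIV. structure_fun mul e X j k m g * ?v m n) *\<^sub>R ?d n F g)"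
    unfolding structure_equation[OF g] ..
  also have "\<dots> = (\<Sum>n\<in>UNIV. structure_fun mul e X j k n g *\<^sub>R frame_deriv n F g)"
    unfolding frame_deriv_def scaleR_sum_left scaleR_sum_right
    by (subst sum.swap) simp
  finally show ?thesis .
qed

end

section \<open>Integrability of the generalized Lie equations\<close>

locale differentiable_birepresentation =
  moufang_loop_unit_chart mul e \<A> X + birepresentation mul e S T
  for mul :: "'g::t2_space \<Rightarrow> 'g \<Rightarrow> 'g" and e :: 'g and \<A> :: "('g, real^'r::finite) chart set"
    and X :: "('g, real^'r) chart" and S T :: "'g \<Rightarrow> 'k::real_normed_field^'n::finite^'n" +
  assumes differentiable_S: "differentiable_map {X} S"
    and differentiable_T: "differentiable_map {X} T"
begin

abbreviation "S_gen \<equiv> S_deriv_gen e X S T"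
abbreviation "T_gen \<equiv> T_deriv_gen e X S T"

lemma frame_deriv_S:
  assumes "g \<in> chart_dom X"
  shows "frame_deriv j S g = S g ** S_gen j g"
proof -
  have "bounded_linear (\<lambda>M. T g ** S g ** M ** matrix_inv (T g))"
    by (intro matrix_mult.bounded_linear_left[THEN bounded_linear_compose] matrix_mult.bounded_linear_right)
  then have "frame_deriv j S g = T g ** S g ** coord_deriv X j S e ** matrix_inv (T g)"
    by (rule frame_deriv_of_equivariant[OF differentiable_S assms]) (rule S_mult)
  then show ?thesis
    by (simp add: S_deriv_gen_def S_T_commute matrix_mul_assoc)
qed

lemma frame_deriv_T:
  assumes "g \<in> chart_dom X"
  shows "frame_deriv j T g = T_gen j g ** T g"
proof -
  have "bounded_linear (\<lambda>M. matrix_inv (S g) ** M ** S g ** T g)"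
    by (intro matrix_mult.bounded_linear_left[THEN bounded_linear_compose] matrix_mult.bounded_linear_right)
  then have "frame_deriv j T g = matrix_inv (S g) ** coord_deriv X j T e ** S g ** T g"
    by (rule frame_deriv_of_equivariant[OF differentiable_T assms]) (rule T_mult)
  then show ?thesis
    by (simp add: T_deriv_gen_def)
qed

lemma has_derivative_S_T:
  assumes "g \<in> chart_dom X"
  shows "\<exists>D. ((S \<circ> point) has_derivative D) (at (coords g))" "\<exists>D. ((T \<circ> point) has_derivative D) (at (coords g))"
  using differentiable_S differentiable_T assms unfolding differentiable_in_chart_iff by blast+

lemma has_derivative_inv_S_T:
  assumes "g \<in> chart_dom X"
  shows "((S \<circ> point) has_derivative D) (at (coords g)) \<Longrightarrow>
      ((\<lambda>x. matrix_inv (S (point x))) has_derivative (\<lambda>h. - (matrix_inv (S g) ** D h ** matrix_inv (S g)))) (at (coords g))"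
    and "((T \<circ> point) has_derivative D) (at (coords g)) \<Longrightarrow>
      ((\<lambda>x. matrix_inv (T (point x))) has_derivative (\<lambda>h. - (matrix_inv (T g) ** D h ** matrix_inv (T g)))) (at (coords g))"
  using has_derivative_matrix_inv[of "S \<circ> point" D "coords g"] has_derivative_matrix_inv[of "T \<circ> point" D "coords g"]
  by (simp_all add: invertible_S invertible_T point_coords[OF assms])

lemma differentiable_inv_S_T:
  shows "differentiable_map {X} (\<lambda>g. matrix_inv (S g))" "differentiable_map {X} (\<lambda>g. matrix_inv (T g))"
  unfolding differentiable_in_chart_iff o_def using has_derivative_S_T has_derivative_inv_S_T by blast+

lemma has_derivative_S_gen:
  assumes g: "g \<in> chart_dom X" and D: "((T \<circ> point) has_derivative D) (at (coords g))"
  shows "((S_gen k \<circ> point) has_derivative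
    (\<lambda>h. D h ** coord_deriv X k S e ** matrix_inv (T g) - S_gen k g ** D h ** matrix_inv (T g))) (at (coords g))"
proof -
  have "((\<lambda>x. T (point x) ** coord_deriv X k S e ** matrix_inv (T (point x))) has_derivative
    (\<lambda>h. T g ** coord_deriv X k S e ** - (matrix_inv (T g) ** D h ** matrix_inv (T g))
      + (T g ** 0 + D h ** coord_deriv X k S e) ** matrix_inv (T g))) (at (coords g))"
    using has_derivative_matrix_mult[OF has_derivative_matrix_mult[OF D[unfolded o_def] has_derivative_const]
        has_derivative_inv_S_T(2)[OF g D]]
    by (simp add: point_coords[OF g])
  then show ?thesis
    unfolding S_deriv_gen_def[abs_def] o_def
    by (rule has_derivative_eq_rhs) (simp add: matrix_mult.minus_right matrix_mul_assoc)
qed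

text \<open>
  Only \<open>T\<close> varies in \<open>T\<^sub>g S\<^sub>k T\<^sub>g\<^sup>-\<^sup>1\<close>, and \<open>V\<^sub>j T = \<tau>\<^sub>j T\<close> makes \<open>V\<^sub>j\<close> act on a conjugate by \<open>T\<close> as the
  commutator with \<open>\<tau>\<^sub>j\<close>.
\<close>

lemma frame_deriv_S_gen:
  assumes g: "g \<in> chart_dom X"
  shows "frame_deriv j (S_gen k) g = commutator (T_gen j g) (S_gen k g)"
proof -
  obtain D where D: "((T \<circ> point) has_derivative D) (at (coords g))"
    using has_derivative_S_T(2)[OF g] by blast
  have "D (frame j g) = T_gen j g ** T g"
    using frame_deriv_T[OF g] frame_deriv_eq[OF D] by simp
  then have "frame_deriv j (S_gen k) g
    = T_gen j g ** T g ** coord_deriv X k S e ** matrix_inv (T g) - S_gen k g ** (T_gen j g ** T g) ** matrix_inv (T g)"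
    unfolding frame_deriv_eq[OF has_derivative_S_gen[OF g D]] by simp
  also have "S_gen k g ** (T_gen j g ** T g) ** matrix_inv (T g) = S_gen k g ** T_gen j g"
    by (simp add: matrix_mul_assoc matrix_inv_cancel invertible_T)
  finally show ?thesis
    by (simp add: commutator_def S_deriv_gen_def[of e X S T k g] matrix_mul_assoc)
qed

lemma has_derivative_frame_deriv_S:
  assumes g: "g \<in> chart_dom X" and S': "((S \<circ> point) has_derivative S') (at (coords g))"
    and D: "((S_gen k \<circ> point) has_derivative D) (at (coords g))"
  shows "((frame_deriv k S \<circ> point) has_derivative (\<lambda>h. S g ** D h + S' h ** S_gen k g)) (at (coords g))"
proof (rule differentiable_at_point_cong[OF _ g])
  show "(((\<lambda>g. S g ** S_gen k g) \<circ> point) has_derivative (\<lambda>h. S g ** D h + S' h ** S_gen k g)) (at (coords g))"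
    using has_derivative_matrix_mult[OF S' D] by (simp add: o_def point_coords[OF g])
qed (simp add: frame_deriv_S)

lemma differentiable_frame_deriv_S: "differentiable_map {X} (frame_deriv k S)"
  unfolding differentiable_in_chart_iff
  using has_derivative_S_T has_derivative_S_gen has_derivative_frame_deriv_S by blast

text \<open>
  The infinitesimal form of \<open>isotope_translations_commute\<close>, with \<open>h\<close> moving along a straight line of the
  chart in an arbitrary direction \<open>w\<close>, polarized in \<open>w\<close>.
\<close>

lemma S_T_gen_exchange:
  "commutator (S_gen j g) (T_gen k g) + commutator (S_gen k g) (T_gen j g) = 0"
proof -
  obtain DS where DS: "((S \<circ> point) has_derivative DS) (at (coords e))"
    using has_derivative_S_T(1)[OF unit_in_dom] by blast
  obtain DT where DT: "((T \<circ> point) has_derivative DT) (at (coords e))"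
    using has_derivative_S_T(2)[OF unit_in_dom] by blast
  define s t where "s w = T g ** DS w ** matrix_inv (T g)" and "t w = matrix_inv (S g) ** DT w ** S g" for w
  have comm: "s w ** t w = t w ** s w" for w
  proof (rule commuting_curves_imp_commuting_velocities)
    let ?h = "\<lambda>\<tau>. point (coords e + \<tau> *\<^sub>R w)"
    have line: "((\<lambda>\<tau>. coords e + \<tau> *\<^sub>R w) has_derivative (\<lambda>\<tau>. \<tau> *\<^sub>R w)) (at 0)"
      by (auto intro!: derivative_eq_intros)
    have curve: "((\<lambda>\<tau>. M ** F (?h \<tau>) ** N) has_vector_derivative M ** D w ** N) (at 0)"
      if "((F \<circ> point) has_derivative D) (at (coords e))" for F :: "'g \<Rightarrow> 'k^'n^'n" and D M N
    proof -
      have "((\<lambda>\<tau>. (F \<circ> point) (coords e + \<tau> *\<^sub>R w)) has_derivative (\<lambda>\<tau>. D (\<tau> *\<^sub>R w))) (at 0)"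
        by (rule has_derivative_compose[OF line]) (use that in \<open>simp add: o_def\<close>)
      moreover have "D (\<tau> *\<^sub>R w) = \<tau> *\<^sub>R D w" for \<tau>
        using that by (simp add: has_derivative_bounded_linear linear_cmul bounded_linear.linear)
      ultimately have "((\<lambda>\<tau>. F (?h \<tau>)) has_derivative (\<lambda>\<tau>. \<tau> *\<^sub>R D w)) (at 0)"
        by (simp add: o_def)
      from has_derivative_matrix_mult[OF has_derivative_matrix_mult[OF has_derivative_const[of M] this] has_derivative_const[of N]]
      show ?thesis
        by (simp add: has_vector_derivative_def matrix_mult.scaleR_left matrix_mult.scaleR_right)
    qed
    show "((\<lambda>\<tau>. T g ** S (?h \<tau>) ** matrix_inv (T g)) has_vector_derivative s w) (at 0)"
      "((\<lambda>\<tau>. matrix_inv (S g) ** T (?h \<tau>) ** S g) has_vector_derivative t w) (at 0)"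
      unfolding s_def t_def by (rule curve[OF DS] curve[OF DT])+
    show "T g ** S (?h 0) ** matrix_inv (T g) = mat 1" "matrix_inv (S g) ** T (?h 0) ** S g = mat 1"
      by (simp_all add: point_coords unit_in_dom S_unit T_unit matrix_inv_left_right invertible_S invertible_T)
  qed (rule isotope_translations_commute)
  have add: "s (u + w) = s u + s w" "t (u + w) = t u + t w" for u w
    unfolding s_def t_def
    using linear_add[OF has_derivative_linear[OF DS]] linear_add[OF has_derivative_linear[OF DT]]
    by (simp_all add: matrix_mult.add_left matrix_mult.add_right)
  \<comment> \<open>Polarization: the quadratic identity is used at \<open>u + w\<close>, \<open>u\<close> and \<open>w\<close>.\<close>
  let ?u = "axis j 1" and ?w = "axis k 1"
  have gens: "s (axis i 1) = S_gen i g" "t (axis i 1) = T_gen i g" for i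
    by (simp_all add: s_def t_def S_deriv_gen_def T_deriv_gen_def coord_deriv_eq[OF DS] coord_deriv_eq[OF DT])
  show ?thesis
    using comm[of "?u + ?w"] comm[of ?u] comm[of ?w]
    unfolding add gens commutator_def matrix_mult.add_left matrix_mult.add_right
    by (simp add: algebra_simps)
qed

text \<open>
  The bracket identity \<open>V\<^sub>j V\<^sub>k S - V\<^sub>k V\<^sub>j S = c\<^sub>j\<^sub>k\<^sup>n V\<^sub>n S\<close>, with \<open>V\<^sub>j S = S \<sigma>\<^sub>j\<close> inserted and the factor \<open>S\<close>
  cancelled, contains \<open>[\<tau>\<^sub>j, \<sigma>\<^sub>k]\<close> and \<open>-[\<tau>\<^sub>k, \<sigma>\<^sub>j]\<close>; both equal \<open>[\<sigma>\<^sub>j, \<tau>\<^sub>k]\<close> by \<open>S_T_gen_exchange\<close>,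
  which accounts for the factor \<open>2\<close>.
\<close>

lemma commutator_S_gen:
  assumes g: "g \<in> chart_dom X"
  shows "commutator (S_gen j g) (S_gen k g)
    = (\<Sum>n\<in>UNIV. structure_fun mul e X j k n g *\<^sub>R S_gen n g) - 2 *\<^sub>R commutator (S_gen j g) (T_gen k g)"
proof -
  let ?c = "\<Sum>n\<in>UNIV. structure_fun mul e X j k n g *\<^sub>R S_gen n g"
  have second: "frame_deriv j (frame_deriv k S) g
      = S g ** (S_gen j g ** S_gen k g + commutator (T_gen j g) (S_gen k g))" for j k
  proof -
    obtain S' T' where S': "((S \<circ> point) has_derivative S') (at (coords g))"
      and T': "((T \<circ> point) has_derivative T') (at (coords g))"
      using has_derivative_S_T[OF g] by blast
    note gen' = has_derivative_S_gen[OF g T']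
    have "frame_deriv j (frame_deriv k S) g = S g ** frame_deriv j (S_gen k) g + frame_deriv j S g ** S_gen k g"
      unfolding frame_deriv_eq[OF has_derivative_frame_deriv_S[OF g S' gen']] frame_deriv_eq[OF gen'] frame_deriv_eq[OF S'] ..
    then show ?thesis
      by (simp add: frame_deriv_S[OF g] frame_deriv_S_gen[OF g] matrix_mult.add_right matrix_mul_assoc)
  qed
  have "S g ** (S_gen j g ** S_gen k g + commutator (T_gen j g) (S_gen k g)
        - (S_gen k g ** S_gen j g + commutator (T_gen k g) (S_gen j g))) = S g ** ?c"
    using frame_deriv_bracket[OF differentiable_S differentiable_coord_deriv[OF differentiable_frame_deriv_S] g, of j k]
    unfolding second frame_deriv_S[OF g]
    by (simp add: matrix_mult.diff_right matrix_mult.sum_right matrix_mult.scaleR_right)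
  then have "matrix_inv (S g) ** (S g ** (S_gen j g ** S_gen k g + commutator (T_gen j g) (S_gen k g)
        - (S_gen k g ** S_gen j g + commutator (T_gen k g) (S_gen j g)))) = matrix_inv (S g) ** (S g ** ?c)"
    by simp
  then have "commutator (S_gen j g) (S_gen k g) + commutator (T_gen j g) (S_gen k g) - commutator (T_gen k g) (S_gen j g) = ?c"
    unfolding matrix_inv_cancel(2)[OF invertible_S] by (simp add: commutator_def algebra_simps)
  moreover have "commutator (T_gen j g) (S_gen k g) = commutator (S_gen j g) (T_gen k g)"
    using S_T_gen_exchange[of j g k] by (simp add: commutator_def algebra_simps)
  moreover have "commutator (T_gen k g) (S_gen j g) = - commutator (S_gen j g) (T_gen k g)"
    by (simp add: commutator_def)
  ultimately have "?c = commutator (S_gen j g) (S_gen k g) + 2 *\<^sub>R commutator (S_gen j g) (T_gen k g)"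
    by (simp add: scaleR_2 add.commute)
  then show ?thesis by simp
qed

lemma dual_differentiable_birepresentation:
  "differentiable_birepresentation mul e \<A> X (\<lambda>g. matrix_inv (T g)) (\<lambda>g. matrix_inv (S g))"
  by (intro differentiable_birepresentation.intro differentiable_birepresentation_axioms.intro
      moufang_loop_unit_chart_axioms dual_birepresentation differentiable_inv_S_T)

text \<open>
  The sign comes from differentiating an inverse at the identity matrix; it produces the minus sign before
  the structure functions in the relations for \<open>T\<close>.
\<close>

lemma dual_generators:
  shows "S_deriv_gen e X (\<lambda>g. matrix_inv (T g)) (\<lambda>g. matrix_inv (S g)) j g = - T_gen j g"
    and "T_deriv_gen e X (\<lambda>g. matrix_inv (T g)) (\<lambda>g. matrix_inv (S g)) j g = - S_gen j g"
proof -
  have inv_inv: "matrix_inv (matrix_inv (S g)) = S g" "matrix_inv (matrix_inv (T g)) = T g"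
    by (intro matrix_inv_eqI matrix_inv_left_right invertible_S invertible_T)+
  obtain S' T' where S': "((S \<circ> point) has_derivative S') (at (coords e))"
    and T': "((T \<circ> point) has_derivative T') (at (coords e))"
    using has_derivative_S_T[OF unit_in_dom] by blast
  have inv_unit: "matrix_inv (mat 1 :: 'k^'n^'n) = mat 1" by (rule matrix_inv_eqI) simp
  have "coord_deriv X j (\<lambda>g. matrix_inv (S g)) e = - coord_deriv X j S e"
    using coord_deriv_eq[of "\<lambda>g. matrix_inv (S g)", unfolded o_def, OF has_derivative_inv_S_T(1)[OF unit_in_dom S'], of j]
    by (simp add: coord_deriv_eq[OF S'] S_unit inv_unit)
  moreover have "coord_deriv X j (\<lambda>g. matrix_inv (T g)) e = - coord_deriv X j T e"
    using coord_deriv_eq[of "\<lambda>g. matrix_inv (T g)", unfolded o_def, OF has_derivative_inv_S_T(2)[OF unit_in_dom T'], of j]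
    by (simp add: coord_deriv_eq[OF T'] T_unit inv_unit)
  ultimately show "S_deriv_gen e X (\<lambda>g. matrix_inv (T g)) (\<lambda>g. matrix_inv (S g)) j g = - T_gen j g"
    "T_deriv_gen e X (\<lambda>g. matrix_inv (T g)) (\<lambda>g. matrix_inv (S g)) j g = - S_gen j g"
    by (simp_all add: S_deriv_gen_def T_deriv_gen_def inv_inv matrix_mult.minus_left matrix_mult.minus_right)
qed

lemma commutator_T_gen:
  assumes "g \<in> chart_dom X"
  shows "commutator (T_gen j g) (T_gen k g)
    = - (\<Sum>n\<in>UNIV. structure_fun mul e X j k n g *\<^sub>R T_gen n g) - 2 *\<^sub>R commutator (T_gen j g) (S_gen k g)"
  using differentiable_birepresentation.commutator_S_gen[OF dual_differentiable_birepresentation assms, of j k]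
  unfolding dual_generators
  by (simp add: commutator_def matrix_mult.minus_left matrix_mult.minus_right sum_negf)

lemma differentiable_frame_deriv_T: "differentiable_map {X} (frame_deriv k T)"
  unfolding differentiable_in_chart_iff
proof
  fix g assume g: "g \<in> chart_dom X"
  obtain S' T' where S': "((S \<circ> point) has_derivative S') (at (coords g))"
    and T': "((T \<circ> point) has_derivative T') (at (coords g))"
    using has_derivative_S_T[OF g] by blast
  have "\<exists>D. ((\<lambda>x. matrix_inv (S (point x)) ** coord_deriv X k T e ** S (point x) ** T (point x)) has_derivative D) (at (coords g))"
    by (rule exI has_derivative_matrix_mult has_derivative_const has_derivative_inv_S_T(1)[OF g S'] S'[unfolded o_def] T'[unfolded o_def])+
  then obtain D where "(((\<lambda>g. T_gen k g ** T g) \<circ> point) has_derivative D) (at (coords g))"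
    unfolding T_deriv_gen_def o_def by blast
  then have "((frame_deriv k T \<circ> point) has_derivative D) (at (coords g))"
    by (rule differentiable_at_point_cong[OF _ g]) (simp add: frame_deriv_T)
  then show "\<exists>D. ((frame_deriv k T \<circ> point) has_derivative D) (at (coords g))" by blast
qed

end

theorem theorem2:
  fixes mul :: "'g::t2_space \<Rightarrow> 'g \<Rightarrow> 'g"
    and e :: 'g
    and \<A> :: "('g, real^'r::finite) chart set"
    and S T :: "'g \<Rightarrow> 'k::real_normed_field^'n::finite^'n"
    and X :: "('g, real^'r) chart"
    and v :: "'r \<Rightarrow> 'r \<Rightarrow> 'g \<Rightarrow> real"
    and c :: "'r \<Rightarrow> 'r \<Rightarrow> 'r \<Rightarrow> 'g \<Rightarrow> real"
    and dS dT Sgen Tgen :: "'r \<Rightarrow> 'g \<Rightarrow> 'k^'n^'n"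
  assumes "analytic_moufang_loop mul e \<A>"
    and "birepresentation mul e S T"
    and "differentiable_map \<A> S"
    and "differentiable_map \<A> T"
    and "X \<in> \<A>"
    and "e \<in> chart_dom X"
    and "v = aux_fun mul e X"
    and "c = structure_fun mul e X"
    and "dS = (\<lambda>j. coord_deriv X j S)"
    and "dT = (\<lambda>j. coord_deriv X j T)"
    and "Sgen = S_deriv_gen e X S T"
    and "Tgen = T_deriv_gen e X S T"
  shows "\<forall>g\<in>chart_dom X. \<forall>j k.
      (\<Sum>n\<in>UNIV. v j n g *\<^sub>R dS n g) = S g ** Sgen j g \<and>
      (\<Sum>n\<in>UNIV. v j n g *\<^sub>R dT n g) = Tgen j g ** T g \<and>
      coord_deriv X j (dS k) g = coord_deriv X k (dS j) g \<and>
      coord_deriv X j (dT k) g = coord_deriv X k (dT j) g \<and>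
      commutator (Sgen j g) (Sgen k g) =
        (\<Sum>n\<in>UNIV. c j k n g *\<^sub>R Sgen n g) - 2 *\<^sub>R commutator (Sgen j g) (Tgen k g) \<and>
      commutator (Tgen j g) (Tgen k g) =
        - (\<Sum>n\<in>UNIV. c j k n g *\<^sub>R Tgen n g) - 2 *\<^sub>R commutator (Tgen j g) (Sgen k g)"
proof -
  have "differentiable_map {X} S" "differentiable_map {X} T"
    using assms(3-5) by (simp_all add: differentiable_map_def)
  with assms(1,2,5,6) interpret differentiable_birepresentation mul e \<A> X S T
    by (intro differentiable_birepresentation.intro differentiable_birepresentation_axioms.intro
        moufang_loop_unit_chart.intro moufang_loop_unit_chart_axioms.intro)
  show ?thesis
    unfolding assms(7-12)
    by (intro ballI allI conjI frame_deriv_S[unfolded frame_deriv_def] frame_deriv_T[unfolded frame_deriv_def]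
        coord_derivs_commute[OF differentiable_S differentiable_coord_deriv[OF differentiable_frame_deriv_S]]
        coord_derivs_commute[OF differentiable_T differentiable_coord_deriv[OF differentiable_frame_deriv_T]]
        commutator_S_gen commutator_T_gen)
qed

end
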